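(* Let $\lambda\in(0,\infty)$ and $\tau\in\mathbb{R}$, let $\{\rho_n\}_{n\ge1}$ be the correlations of the bivariate Gaussian triangular array, and put $\lambda_n=\left(\tfrac12 b_n^2(1-\rho_n)\right)^{1/2}$. Suppose that $$\lim_{n\to\infty}b_n^2(\lambda-\lambda_n)=\tau .$$ Then for all $x>0$, $y>0$, $$\lim_{n\to\infty}b_n^2\left(F_n^{\,n}\big(b_nx^{b_n^{-2}},\,b_ny^{b_n^{-2}}\big)-H_\lambda(\ln x,\ln y)\right)=\kappa(x,y,\lambda,\tau)\,H_\lambda(\ln x,\ln y),$$ where $$\kappa(x,y,\lambda,\tau)=\big((\ln x)^2+\ln x\big)x^{-1}\Phi\Big(\lambda+\frac{\ln\frac{y}{x}}{2\lambda}\Big)+\big((\ln y)^2+\ln y\big)y^{-1}\Phi\Big(\lambda+\frac{\ln\frac{x}{y}}{2\lambda}\Big)+\big(2\tau-\lambda^3-2\lambda-\lambda\ln y-\lambda\ln x\big)x^{-1}\varphi\Big(\lambda+\frac{\ln\frac{y}{x}}{2\lambda}\Big).$$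
   Context: $\Phi$ and $\varphi=\Phi'$ denote the standard normal distribution function and density. The norming constants $b_n$ are defined by $n(1-\Phi(b_n))=1$ (for $n\ge 3$, so $b_n>0$ and $b_n\to\infty$). $\{(X_{n,k},Y_{n,k}):1\le k\le n,\ n\ge1\}$ is a triangular array of independent standard bivariate Gaussian random vectors (zero means, unit variances); all vectors in row $n$ have correlation $\rho_n\in[-1,1]$, and $F_n$ denotes their common joint distribution function, $F_n(s,t)=\mathbb{P}(X_{n,1}\le s,Y_{n,1}\le t)$. Thus $F_n^{\,n}(s,t)=(F_n(s,t))^n$ is the joint distribution function of the componentwise maxima of row $n$. For $\lambda\in(0,\infty)$, the Hüsler–Reiss distribution is $$H_\lambda(s,t)=\exp\left(-\Phi\Big(\lambda+\frac{s-t}{2\lambda}\Big)e^{-t}-\Phi\Big(\lambda+\frac{t-s}{2\lambda}\Big)e^{-s}\right),\quad s,t\in\mathbb{R}.$$ *)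

theory Defs
  imports "HOL-Probability.Probability"
begin

abbreviation std_normal_cdf :: "real \<Rightarrow> real" where
  "std_normal_cdf \<equiv> cdf std_normal_distribution"

text \<open>A bivariate Gaussian vector is one distributed as an affine image of a pair of independent
  standard normal variables. Degenerate (singular) Gaussian laws are included, which is needed for
  correlation 1 and -1.\<close>

definition (in prob_space) bivariate_gaussian :: "('a \<Rightarrow> real) \<Rightarrow> ('a \<Rightarrow> real) \<Rightarrow> bool" where
  "bivariate_gaussian X Y \<longleftrightarrow>
     random_variable borel X \<and> random_variable borel Y \<and>
     (\<exists>m1 m2 a11 a12 a21 a22 :: real.
        distr M borel (\<lambda>\<omega>. (X \<omega>, Y \<omega>)) =
        distr (std_normal_distribution \<Otimes>\<^sub>M std_normal_distribution) borel
          (\<lambda>(z, w). (m1 + a11 * z + a12 * w, m2 + a21 * z + a22 * w)))"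

definition (in prob_space) standard_bivariate_gaussian ::
    "('a \<Rightarrow> real) \<Rightarrow> ('a \<Rightarrow> real) \<Rightarrow> bool" where
  "standard_bivariate_gaussian X Y \<longleftrightarrow>
     bivariate_gaussian X Y \<and>
     expectation X = 0 \<and> expectation Y = 0 \<and> variance X = 1 \<and> variance Y = 1"

definition (in prob_space) correlation :: "('a \<Rightarrow> real) \<Rightarrow> ('a \<Rightarrow> real) \<Rightarrow> real" where
  "correlation X Y =
     expectation (\<lambda>\<omega>. (X \<omega> - expectation X) * (Y \<omega> - expectation Y)) /
     (sqrt (variance X) * sqrt (variance Y))"

definition (in prob_space) joint_cdf :: "('a \<Rightarrow> real) \<Rightarrow> ('a \<Rightarrow> real) \<Rightarrow> real \<Rightarrow> real \<Rightarrow> real" where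
  "joint_cdf X Y s t = prob {\<omega> \<in> space M. X \<omega> \<le> s \<and> Y \<omega> \<le> t}"

text \<open>Row \<open>n\<close> of the array consists of the vectors with indices \<open>1, \<dots>, n\<close>; independence is required
  within each row only, nothing being assumed about the joint law of different rows.\<close>

definition (in prob_space) gaussian_triangular_array ::
    "(nat \<Rightarrow> nat \<Rightarrow> 'a \<Rightarrow> real) \<Rightarrow> (nat \<Rightarrow> nat \<Rightarrow> 'a \<Rightarrow> real) \<Rightarrow> (nat \<Rightarrow> real) \<Rightarrow> bool" where
  "gaussian_triangular_array X Y \<rho> \<longleftrightarrow>
     (\<forall>n\<ge>1.
        - 1 \<le> \<rho> n \<and> \<rho> n \<le> 1 \<and>
        indep_vars (\<lambda>_. borel) (\<lambda>k \<omega>. (X n k \<omega>, Y n k \<omega>)) {1..n} \<and>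
        (\<forall>k\<in>{1..n}. standard_bivariate_gaussian (X n k) (Y n k) \<and>
                    correlation (X n k) (Y n k) = \<rho> n))"

definition husler_reiss :: "real \<Rightarrow> real \<Rightarrow> real \<Rightarrow> real" where
  "husler_reiss lam s t =
     exp (- std_normal_cdf (lam + (s - t) / (2 * lam)) * exp (- t)
          - std_normal_cdf (lam + (t - s) / (2 * lam)) * exp (- s))"

definition kappa :: "real \<Rightarrow> real \<Rightarrow> real \<Rightarrow> real \<Rightarrow> real" where
  "kappa x y lam \<tau> =
     ((ln x)\<^sup>2 + ln x) * inverse x * std_normal_cdf (lam + ln (y / x) / (2 * lam))
   + ((ln y)\<^sup>2 + ln y) * inverse y * std_normal_cdf (lam + ln (x / y) / (2 * lam))
   + (2 * \<tau> - lam ^ 3 - 2 * lam - lam * ln y - lam * ln x) * inverse x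
       * std_normal_density (lam + ln (y / x) / (2 * lam))"

end

theory Submission
  imports Defs "HOL-Real_Asymp.Real_Asymp"
begin

text \<open>
  Write \<open>u = ln x\<close>, \<open>v = ln y\<close>, \<open>w = b\<^sub>n\<^sup>2\<close>, \<open>s = b\<^sub>n exp (u / w)\<close> and \<open>t = b\<^sub>n exp (v / w)\<close>, the two
  levels of the theorem. The claim is a first-order expansion in the small parameter
  \<open>1 / w\<close>. Raising to the \<open>n\<close>-th power is harmless because \<open>w / n \<longlongrightarrow> 0\<close>
  (\<open>expands_power\<close>), so everything rests on the expansion of
  \<open>n * (1 - F\<^sub>n s t)\<close> to that order (\<open>expands_exceedance\<close>).

  The key is an exact formula for \<open>1 - F\<^sub>n s t\<close>
  (\<open>joint_cdf_standard_bivariate_gaussian\<close>). Represent the vector as \<open>(X, r X + \<sigma> Q)\<close> with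
  \<open>X\<close>, \<open>Q\<close> independent standard normal and \<open>\<sigma>\<^sup>2 = 1 - r\<^sup>2\<close>, and integrate over \<open>X\<close> first:
  given \<open>Q = q\<close>, the event \<open>X > s, Y \<le> t\<close> confines \<open>X\<close> to an interval, so that its
  probability is a difference of two normal tails. The substitution \<open>q \<mapsto> \<sigma> t - r q\<close> is the
  trace of a rotation of the plane, under which \<open>\<phi> z \<phi> q'\<close> becomes \<open>\<phi> t \<phi> q\<close>; it yields,
  with \<open>T\<close> the normal tail, \<open>R = T / \<phi>\<close> the Mills ratio, \<open>A = (t - r s) / \<sigma>\<close> and
  \<open>B = (s - r t) / \<sigma>\<close>,

  \<open>1 - F\<^sub>n s t = T s \<Phi> A + T t (\<Phi> B - J)\<close>, where \<open>J\<close> is the integral over \<open>q \<ge> B\<close> of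
  \<open>(r R (r t + \<sigma> q) / R t - 1) \<phi> q\<close>.

  Each ingredient now has an elementary expansion. \<open>A\<close> and \<open>B\<close> are explicit functions of
  \<open>1 / w\<close> and \<open>\<lambda>\<^sub>n\<close>; \<open>n T s\<close> and \<open>n T t\<close> follow from \<open>z R z = 1 - 1/z\<^sup>2 + O(z\<^sup>-\<^sup>4)\<close>; and since
  \<open>w (r R (r t + \<sigma> q) / R t - 1) \<longlongrightarrow> - 2 \<lambda> q\<close> for each \<open>q\<close>, dominated convergence gives
  \<open>w J \<longlongrightarrow> - 2 \<lambda> \<phi> B\<close> (\<open>expands_mills_integral\<close>). Since
  \<open>exp (- u) \<phi> A = exp (- v) \<phi> B\<close> in the limit, all density terms merge into the last
  summand of \<open>kappa\<close>.
\<close>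

section \<open>First-order expansions\<close>

text \<open>
  This is \<open>f n = c + d / w n + o(1 / w n)\<close> with \<open>w n \<longlongrightarrow> \<infinity>\<close>. The pairs \<open>(c, d)\<close> obey the
  calculus of first derivatives, which turns the whole computation into bookkeeping.
\<close>
definition expands :: "(nat \<Rightarrow> real) \<Rightarrow> (nat \<Rightarrow> real) \<Rightarrow> real \<Rightarrow> real \<Rightarrow> bool" where
  "expands w f c d \<longleftrightarrow>
     filterlim w at_top sequentially \<and> (\<lambda>n. w n * (f n - c)) \<longlonglongrightarrow> d"

lemma expands_tendsto:
  assumes "expands w f c d" shows "f \<longlonglongrightarrow> c"
proof -
  have w: "filterlim w at_top sequentially" and d: "(\<lambda>n. w n * (f n - c)) \<longlonglongrightarrow> d"
    using assms by (auto simp: expands_def)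
  have "(\<lambda>n. w n * (f n - c) * inverse (w n) + c) \<longlonglongrightarrow> d * 0 + c"
    by (intro tendsto_intros d tendsto_inverse_0_at_top w)
  moreover have "eventually (\<lambda>n. w n * (f n - c) * inverse (w n) + c = f n) sequentially"
    using filterlim_at_top_dense[THEN iffD1, OF w, rule_format, of 0]
    by eventually_elim (simp add: field_simps)
  ultimately show ?thesis by (simp add: tendsto_cong)
qed

lemma expands_cong:
  assumes "expands w f c d" "eventually (\<lambda>n. f n = g n) sequentially"
  shows "expands w g c d"
proof -
  have "eventually (\<lambda>n. w n * (f n - c) = w n * (g n - c)) sequentially"
    using assms(2) by eventually_elim simp
  from tendsto_cong[OF this] show ?thesis using assms(1) by (simp add: expands_def)
qed

lemma expands_const:
  assumes "filterlim w at_top sequentially"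
  shows "expands w (\<lambda>n. c) c 0"
  using assms by (simp add: expands_def)

lemma expands_add:
  assumes "expands w f c d" "expands w g c' d'"
  shows "expands w (\<lambda>n. f n + g n) (c + c') (d + d')"
proof -
  have "(\<lambda>n. w n * (f n - c) + w n * (g n - c')) \<longlonglongrightarrow> d + d'"
    using assms by (intro tendsto_add) (auto simp: expands_def)
  then show ?thesis using assms by (simp add: expands_def algebra_simps)
qed

lemma expands_mult:
  assumes f: "expands w f c d" and g: "expands w g c' d'"
  shows "expands w (\<lambda>n. f n * g n) (c * c') (d * c' + c * d')"
proof -
  have "(\<lambda>n. w n * (f n - c) * g n + c * (w n * (g n - c'))) \<longlonglongrightarrow> d * c' + c * d'"
    using assms expands_tendsto[OF g] by (intro tendsto_intros) (auto simp: expands_def)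
  then show ?thesis using assms by (simp add: expands_def algebra_simps)
qed

text \<open>
  The delta method. The difference quotient, extended by its limit \<open>D\<close> at \<open>c\<close>, is continuous
  at \<open>c\<close>, which covers the indices with \<open>f n = c\<close> as well.
\<close>
lemma expands_compose:
  assumes f: "expands w f c d" and h: "(h has_real_derivative D) (at c)"
  shows "expands w (\<lambda>n. h (f n)) (h c) (D * d)"
proof -
  define q where "q y = (if y = c then D else (h y - h c) / (y - c))" for y
  have "isCont q c"
  proof -
    have "((\<lambda>y. (h y - h c) / (y - c)) \<longlongrightarrow> D) (at c)"
      using h by (simp add: has_field_derivative_iff)
    then have "(q \<longlongrightarrow> D) (at c)"
      by (rule Lim_transform_eventually) (auto simp: q_def eventually_at_filter)
    then show ?thesis by (simp add: isCont_def q_def)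
  qed
  then have "(\<lambda>n. q (f n)) \<longlonglongrightarrow> q c"
    using expands_tendsto[OF f] by (rule isCont_tendsto_compose)
  then have "(\<lambda>n. q (f n) * (w n * (f n - c))) \<longlonglongrightarrow> D * d"
    using f by (intro tendsto_mult) (auto simp: expands_def q_def)
  moreover have "q (f n) * (w n * (f n - c)) = w n * (h (f n) - h c)" for n
    by (simp add: q_def)
  ultimately show ?thesis using f by (simp add: expands_def)
qed

lemma expands_cmult:
  assumes "expands w f c d"
  shows "expands w (\<lambda>n. k * f n) (k * c) (k * d)"
  using expands_compose[OF assms, of "\<lambda>x. k * x" k] by (auto intro!: derivative_eq_intros)

lemma expands_diff:
  assumes "expands w f c d" "expands w g c' d'"
  shows "expands w (\<lambda>n. f n - g n) (c - c') (d - d')"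
  using expands_add[OF assms(1) expands_cmult[OF assms(2), of "-1"]] by simp

lemma expands_divide:
  assumes f: "expands w f c d" and g: "expands w g c' d'" and "c' \<noteq> 0"
  shows "expands w (\<lambda>n. f n / g n) (c / c') ((d - c / c' * d') / c')"
proof -
  have "expands w (\<lambda>n. inverse (g n)) (inverse c') (- (inverse c' * inverse c') * d')"
    using \<open>c' \<noteq> 0\<close> by (intro expands_compose[OF g]) (auto intro!: derivative_eq_intros)
  from expands_mult[OF f this] have
    "expands w (\<lambda>n. f n * inverse (g n)) (c * inverse c')
       (d * inverse c' + c * (- (inverse c' * inverse c') * d'))" .
  moreover have "d * inverse c' + c * (- (inverse c' * inverse c') * d') = (d - c / c' * d') / c'"
    using \<open>c' \<noteq> 0\<close> by (simp add: field_simps)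
  ultimately show ?thesis by (simp add: divide_inverse)
qed

lemma expands_vanishing:
  assumes w: "filterlim w at_top sequentially" and f: "f \<longlonglongrightarrow> c"
  shows "expands w (\<lambda>n. f n / w n) 0 c"
proof -
  have "eventually (\<lambda>n. f n = w n * (f n / w n - 0)) sequentially"
    using filterlim_at_top_dense[THEN iffD1, OF w, rule_format, of 0]
    by eventually_elim simp
  then show ?thesis using w f by (auto simp: expands_def dest: tendsto_cong)
qed

lemma expands_exp:
  assumes w: "filterlim w at_top sequentially"
  shows "expands w (\<lambda>n. exp (v / w n)) 1 v"
  using expands_compose[OF expands_vanishing[OF w tendsto_const[of v]], of exp 1]
    DERIV_exp[of "0 :: real"] by simp

text \<open>
  The quantity \<open>w * (exp (v / w) - 1)\<close> is \<open>b * (t - b)\<close> for the level \<open>t = b * exp (v / w)\<close>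
  with \<open>w = b\<^sup>2\<close>. At \<open>2 * v\<close> it is \<open>t\<^sup>2 - b\<^sup>2\<close>, which governs the ratio of the densities at \<open>t\<close>
  and \<open>b\<close>.
\<close>
lemma expands_exp_difference_quotient:
  assumes w: "filterlim w at_top sequentially"
  shows "expands w (\<lambda>n. w n * (exp (v / w n) - 1)) v (v\<^sup>2 / 2)"
proof -
  have "((\<lambda>x::real. x * (x * (exp (v / x) - 1) - v)) \<longlongrightarrow> v\<^sup>2 / 2) at_top"
  proof (cases "v = 0")
    case False
    then consider "v > 0" | "v < 0" by linarith
    then show ?thesis
      by cases (real_asymp simp: power2_eq_square)+
  qed simp
  then have "(\<lambda>n. w n * (w n * (exp (v / w n) - 1) - v)) \<longlonglongrightarrow> v\<^sup>2 / 2"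
    by (rule filterlim_compose[OF _ w])
  then show ?thesis using w by (simp add: expands_def)
qed

text \<open>
  Replacing \<open>n * ln (1 - p n)\<close> by \<open>- n * p n\<close> costs at most \<open>2 * n * (p n)\<^sup>2\<close>. As \<open>n * p n\<close>
  converges, this is of order \<open>1 / n\<close>, which is negligible against \<open>1 / w n\<close> by \<open>wn\<close>.
\<close>
lemma expands_power:
  assumes p: "expands w (\<lambda>n. real n * p n) c d" and wn: "(\<lambda>n. w n / real n) \<longlonglongrightarrow> 0"
  shows "expands w (\<lambda>n. (1 - p n) ^ n) (exp (- c)) (- d * exp (- c))"
proof -
  have np: "(\<lambda>n. real n * p n) \<longlonglongrightarrow> c" by (rule expands_tendsto[OF p])
  have "(\<lambda>n. real n * p n * (1 / real n)) \<longlonglongrightarrow> c * 0"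
    by (intro tendsto_mult np lim_1_over_n)
  moreover have "eventually (\<lambda>n. real n * p n * (1 / real n) = p n) sequentially"
    using eventually_gt_at_top[of 0] by eventually_elim simp
  ultimately have p0: "p \<longlonglongrightarrow> 0" by (simp add: tendsto_cong)
  have "\<forall>\<^sub>F n in sequentially. dist (p n) 0 < 1 / 2"
    using p0 by (rule tendstoD) simp
  then have small: "eventually (\<lambda>n. \<bar>p n\<bar> \<le> 1 / 2) sequentially"
    by eventually_elim (simp add: dist_real_def)
  have w: "filterlim w at_top sequentially" using p by (simp add: expands_def)
  have "(\<lambda>n. w n * (real n * ln (1 - p n) + real n * p n)) \<longlonglongrightarrow> 0"
  proof (rule Lim_null_comparison)
    show "(\<lambda>n. 2 * (real n * p n)\<^sup>2 * (w n / real n)) \<longlonglongrightarrow> 0"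
      using tendsto_mult[OF tendsto_mult[OF tendsto_const tendsto_power[OF np]] wn, of 2 2] by simp
    show "\<forall>\<^sub>F n in sequentially. norm (w n * (real n * ln (1 - p n) + real n * p n))
        \<le> 2 * (real n * p n)\<^sup>2 * (w n / real n)"
      using small eventually_gt_at_top[of 0] filterlim_at_top_dense[THEN iffD1, OF w, rule_format, of 0]
    proof eventually_elim
      case (elim n)
      have "\<bar>ln (1 - p n) + p n\<bar> \<le> 2 * (p n)\<^sup>2"
        using abs_ln_one_plus_x_minus_x_bound[of "- p n"] elim by simp
      then have "w n * real n * \<bar>ln (1 - p n) + p n\<bar> \<le> w n * real n * (2 * (p n)\<^sup>2)"
        using elim by (intro mult_left_mono) auto
      moreover have "w n * (real n * ln (1 - p n) + real n * p n) = w n * real n * (ln (1 - p n) + p n)"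
        by (simp add: algebra_simps)
      moreover have "w n * real n * (2 * (p n)\<^sup>2) = 2 * (real n * p n)\<^sup>2 * (w n / real n)"
        using elim by (simp add: power2_eq_square)
      ultimately show ?case using elim by (simp add: abs_mult)
    qed
  qed
  then have "expands w (\<lambda>n. real n * ln (1 - p n) + real n * p n) 0 0"
    using w by (simp add: expands_def)
  from expands_diff[OF this p] have "expands w (\<lambda>n. real n * ln (1 - p n)) (- c) (- d)" by simp
  from expands_compose[OF this DERIV_exp]
  have "expands w (\<lambda>n. exp (real n * ln (1 - p n))) (exp (- c)) (- d * exp (- c))"
    by (simp add: mult.commute)
  moreover have "eventually (\<lambda>n. exp (real n * ln (1 - p n)) = (1 - p n) ^ n) sequentially"
    using small by eventually_elim (simp add: exp_of_nat_mult)
  ultimately show ?thesis by (rule expands_cong)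
qed

section \<open>The normal tail and Mills ratio\<close>

interpretation std_normal: real_distribution std_normal_distribution
  by (rule real_dist_normal_dist)

lemma has_real_derivative_std_normal_cdf [derivative_intros]:
  assumes "(f has_real_derivative d) (at x within A)"
  shows "((\<lambda>x. std_normal_cdf (f x)) has_real_derivative std_normal_density (f x) * d) (at x within A)"
proof -
  have "(std_normal_cdf has_real_derivative std_normal_density y) (at y)" for y
  proof -
    have cont: "continuous_on S std_normal_density" for S
      unfolding normal_density_def by (intro continuous_intros) auto
    have eq: "std_normal_cdf (y - 1) + integral {y - 1..z} std_normal_density = std_normal_cdf z"
      if "z > y - 1" for z
    proof -
      have "std_normal_cdf z - std_normal_cdf (y - 1) = measure std_normal_distribution {y - 1<..z}"
        using that by (rule std_normal.cdf_diff_eq)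
      also have "\<dots> = (LINT x|std_normal_distribution. indicator {y - 1<..z} x)"
        by simp
      also have "\<dots> = (LINT x|lborel. std_normal_density x * indicator {y - 1<..z} x)"
        by (subst integral_density) auto
      also have "\<dots> = (LINT x:{y - 1..z}|lborel. std_normal_density x)"
        unfolding set_lebesgue_integral_def
        by (rule integral_cong_AE) (auto simp: indicator_def intro!: AE_I[where N="{y - 1}"])
      also have "\<dots> = integral {y - 1..z} std_normal_density"
        by (rule set_borel_integral_eq_integral(2))
           (auto intro!: borel_integrable_atLeastAtMost' cont)
      finally show ?thesis by simp
    qed
    \<comment> \<open>The base point \<open>y - 1\<close> only serves to make \<open>y\<close> an interior point of the interval of integration.\<close>
    have "((\<lambda>z. integral {y - 1..z} std_normal_density) has_real_derivative std_normal_density y)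
            (at y within {y - 1..y + 1})"
      by (rule integral_has_real_derivative) (auto intro: cont)
    then have "((\<lambda>z. integral {y - 1..z} std_normal_density) has_real_derivative std_normal_density y) (at y)"
      by (subst (asm) at_within_interior) (auto simp: interior_atLeastAtMost_real)
    then have "((\<lambda>z. std_normal_cdf (y - 1) + integral {y - 1..z} std_normal_density)
                 has_real_derivative std_normal_density y) (at y)"
      by (auto intro!: derivative_eq_intros)
    then show ?thesis
      by (rule DERIV_cong_ev[THEN iffD1, rotated -1, OF _ refl _ refl])
         (auto intro!: eventually_mono[OF eventually_gt_at_top] simp: eq
           eventually_nhds intro!: exI[of _ "{y - 1<..}"])
  qed
  from DERIV_chain2[OF this assms] show ?thesis .
qed

definition normal_tail :: "real \<Rightarrow> real" where "normal_tail x = 1 - std_normal_cdf x"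

lemma has_real_derivative_normal_tail [derivative_intros]:
  assumes "(f has_real_derivative d) (at x within A)"
  shows "((\<lambda>x. normal_tail (f x)) has_real_derivative - (std_normal_density (f x) * d)) (at x within A)"
  unfolding normal_tail_def using assms by (auto intro!: derivative_eq_intros)

lemma borel_measurable_normal_tail [measurable]: "normal_tail \<in> borel_measurable borel"
  by (auto intro!: borel_measurable_continuous_onI continuous_at_imp_continuous_on
    DERIV_isCont[OF has_real_derivative_normal_tail[OF DERIV_ident]])

lemma has_real_derivative_std_normal_density [derivative_intros]:
  assumes "(f has_real_derivative d) (at x within A)"
  shows "((\<lambda>x. std_normal_density (f x)) has_real_derivative - (f x * std_normal_density (f x) * d)) (at x within A)"
  unfolding std_normal_density_def using assms
  by (auto intro!: derivative_eq_intros simp: power2_eq_square field_simps)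

lemma normal_tail_at_top: "(normal_tail \<longlongrightarrow> 0) at_top"
  unfolding normal_tail_def
  using tendsto_diff[OF tendsto_const std_normal.cdf_lim_at_top_prob, of 1] by simp

lemma std_normal_density_at_top: "(std_normal_density \<longlongrightarrow> 0) at_top"
proof -
  have "((\<lambda>x::real. exp (- x\<^sup>2 / 2)) \<longlongrightarrow> 0) at_top"
    by real_asymp
  from tendsto_mult[OF tendsto_const this, of "1 / sqrt (2 * pi)"] show ?thesis
    by (simp add: std_normal_density_def[abs_def])
qed

lemma nonneg_of_deriv_nonpos_vanishing_at_top:
  fixes f :: "real \<Rightarrow> real"
  assumes "\<And>x. x \<ge> z \<Longrightarrow> (f has_real_derivative f' x) (at x)"
    and "\<And>x. x \<ge> z \<Longrightarrow> f' x \<le> 0" and lim: "(f \<longlongrightarrow> 0) at_top"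
  shows "f z \<ge> 0"
proof -
  have "f x \<le> f z" if "x \<ge> z" for x
    by (rule DERIV_nonpos_imp_nonincreasing[OF that]) (use assms in blast)
  then have "eventually (\<lambda>x. f x \<le> f z) at_top"
    unfolding eventually_at_top_linorder by blast
  then show ?thesis
    using tendsto_upperbound[OF lim] by simp
qed

text \<open>
  The difference \<open>p * std_normal_density - normal_tail\<close> vanishes at infinity and has derivative
  \<open>(p' x + 1 - x * p x) * std_normal_density x\<close>. Hence a sub- or supersolution \<open>p\<close> of
  \<open>p' = x * p - 1\<close>, the differential equation of the Mills ratio, bounds the Mills ratio.
\<close>
lemma normal_tail_compare:
  assumes deriv: "\<And>x. x \<ge> z \<Longrightarrow> (p has_real_derivative p' x) (at x)"
    and lim: "(p \<longlongrightarrow> 0) at_top"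
  shows normal_tail_le: "(\<And>x. x \<ge> z \<Longrightarrow> p' x + 1 \<le> x * p x) \<Longrightarrow>
      normal_tail z \<le> p z * std_normal_density z"
    and normal_tail_ge: "(\<And>x. x \<ge> z \<Longrightarrow> p' x + 1 \<ge> x * p x) \<Longrightarrow>
      normal_tail z \<ge> p z * std_normal_density z"
proof -
  have der: "((\<lambda>x. p x * std_normal_density x - normal_tail x) has_real_derivative
      (p' x + 1 - x * p x) * std_normal_density x) (at x)" if "x \<ge> z" for x
    by (rule derivative_eq_intros deriv[OF that] refl)+ (simp add: algebra_simps)
  have lim': "((\<lambda>x. p x * std_normal_density x - normal_tail x) \<longlongrightarrow> 0) at_top"
    using tendsto_diff[OF tendsto_mult[OF lim std_normal_density_at_top] normal_tail_at_top]
    by simp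
  {
    assume "\<And>x. x \<ge> z \<Longrightarrow> p' x + 1 \<le> x * p x"
    then have "p z * std_normal_density z - normal_tail z \<ge> 0"
      by (intro nonneg_of_deriv_nonpos_vanishing_at_top[OF der _ lim'])
         (auto intro!: mult_nonpos_nonneg)
    then show "normal_tail z \<le> p z * std_normal_density z" by simp
  next
    assume "\<And>x. x \<ge> z \<Longrightarrow> p' x + 1 \<ge> x * p x"
    then have "- (p z * std_normal_density z - normal_tail z) \<ge> 0"
      using tendsto_minus[OF lim']
      by (intro nonneg_of_deriv_nonpos_vanishing_at_top[OF DERIV_minus[OF der]])
         (auto intro!: mult_nonneg_nonneg)
    then show "normal_tail z \<ge> p z * std_normal_density z" by simp
  }
qed

definition mills_ratio :: "real \<Rightarrow> real" where
  "mills_ratio z = normal_tail z / std_normal_density z"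

lemma normal_tail_eq_mills: "normal_tail z = mills_ratio z * std_normal_density z"
  using normal_density_pos[of 1 0 z] by (simp add: mills_ratio_def)

text \<open>
  Truncations of the asymptotic series \<open>1/z - 1/z\<^sup>3 + 3/z\<^sup>5 - \<dots>\<close> are alternately super- and
  subsolutions. The third term is what makes the coefficient of \<open>1 / z\<^sup>2\<close> sharp.
\<close>
lemma mills_ratio_bounds:
  assumes "z > 0"
  shows mills_ratio_upper: "z * mills_ratio z \<le> 1"
    and mills_ratio_lower: "z * mills_ratio z \<ge> 1 - 1 / z\<^sup>2"
    and mills_ratio_upper': "z * mills_ratio z \<le> 1 - 1 / z\<^sup>2 + 3 / z ^ 4"
proof -
  have pos: "x > 0" if "x \<ge> z" for x using assms that by simp
  have "normal_tail z \<le> (1 / z) * std_normal_density z"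
    by (rule normal_tail_le[where p' = "\<lambda>x. - 1 / x\<^sup>2"])
       (use pos in \<open>auto intro!: derivative_eq_intros simp: power2_eq_square field_simps\<close>, real_asymp)
  then show "z * mills_ratio z \<le> 1"
    using assms normal_density_pos[of 1 0 z] by (simp add: mills_ratio_def field_simps)
  have "normal_tail z \<ge> (1 / z - 1 / z ^ 3) * std_normal_density z"
  proof (rule normal_tail_ge[where p' = "\<lambda>x. - 1 / x\<^sup>2 + 3 / x ^ 4"])
    fix x assume "x \<ge> z"
    from pos[OF this] show "((\<lambda>z. 1 / z - 1 / z ^ 3) has_real_derivative - 1 / x\<^sup>2 + 3 / x ^ 4) (at x)"
      by (auto intro!: derivative_eq_intros) (simp add: field_simps eval_nat_numeral)
    show "x * (1 / x - 1 / x ^ 3) \<le> - 1 / x\<^sup>2 + 3 / x ^ 4 + 1"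
      using pos[OF \<open>x \<ge> z\<close>] by (simp add: field_simps eval_nat_numeral)
  qed real_asymp
  then have "z * (1 / z - 1 / z ^ 3) \<le> z * mills_ratio z"
    using assms by (simp add: normal_tail_eq_mills normal_density_pos)
  then show "z * mills_ratio z \<ge> 1 - 1 / z\<^sup>2"
    using assms by (simp add: right_diff_distrib eval_nat_numeral)
  have "normal_tail z \<le> (1 / z - 1 / z ^ 3 + 3 / z ^ 5) * std_normal_density z"
  proof (rule normal_tail_le[where p' = "\<lambda>x. - 1 / x\<^sup>2 + 3 / x ^ 4 - 15 / x ^ 6"])
    fix x assume "x \<ge> z"
    from pos[OF this] show "((\<lambda>z. 1 / z - 1 / z ^ 3 + 3 / z ^ 5) has_real_derivative
        - 1 / x\<^sup>2 + 3 / x ^ 4 - 15 / x ^ 6) (at x)"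
      by (auto intro!: derivative_eq_intros) (simp add: field_simps eval_nat_numeral)
    show "- 1 / x\<^sup>2 + 3 / x ^ 4 - 15 / x ^ 6 + 1 \<le> x * (1 / x - 1 / x ^ 3 + 3 / x ^ 5)"
      using pos[OF \<open>x \<ge> z\<close>] by (simp add: field_simps eval_nat_numeral)
  qed real_asymp
  then have "z * mills_ratio z \<le> z * (1 / z - 1 / z ^ 3 + 3 / z ^ 5)"
    using assms by (simp add: normal_tail_eq_mills normal_density_pos)
  then show "z * mills_ratio z \<le> 1 - 1 / z\<^sup>2 + 3 / z ^ 4"
    using assms by (simp add: right_diff_distrib distrib_left eval_nat_numeral)
qed

lemma mills_ratio_second_order:
  "((\<lambda>z. z\<^sup>2 * (z * mills_ratio z - 1)) \<longlongrightarrow> - 1) at_top"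
proof (rule tendsto_sandwich)
  show "eventually (\<lambda>z. - 1 \<le> z\<^sup>2 * (z * mills_ratio z - 1)) at_top"
    using eventually_gt_at_top[of 0]
  proof eventually_elim
    case (elim z)
    have "z\<^sup>2 * (- 1 / z\<^sup>2) \<le> z\<^sup>2 * (z * mills_ratio z - 1)"
      using mills_ratio_lower[OF elim] by (intro mult_left_mono) auto
    then show ?case using elim by simp
  qed
  show "eventually (\<lambda>z. z\<^sup>2 * (z * mills_ratio z - 1) \<le> z\<^sup>2 * (- 1 / z\<^sup>2 + 3 / z ^ 4)) at_top"
    using eventually_gt_at_top[of 0]
  proof eventually_elim
    case (elim z)
    show ?case
      using mills_ratio_upper'[OF elim] by (intro mult_left_mono) auto
  qed
  show "((\<lambda>z::real. z\<^sup>2 * (- 1 / z\<^sup>2 + 3 / z ^ 4)) \<longlongrightarrow> - 1) at_top" by real_asymp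
qed auto

lemma normal_tail_pos: "normal_tail x > 0"
proof -
  define z where "z = max x 2"
  have "z > 1" by (simp add: z_def)
  then have "z * mills_ratio z > 0"
    by (intro less_le_trans[OF _ mills_ratio_lower]) (auto simp: field_simps)
  with \<open>z > 1\<close> have "normal_tail z > 0"
    by (simp add: normal_tail_eq_mills normal_density_pos zero_less_mult_iff)
  moreover have "normal_tail z \<le> normal_tail x"
    unfolding normal_tail_def using std_normal.cdf_nondecreasing[of x z] by (simp add: z_def)
  ultimately show ?thesis by simp
qed

lemma integrable_density_times_normal_tail:
  assumes [measurable]: "g \<in> borel_measurable borel" "S \<in> sets borel"
  shows "integrable lborel (\<lambda>q. indicator S q * (normal_tail (g q) * std_normal_density q))"
proof (rule Bochner_Integration.integrable_bound[OF integrable_normal_density[of 1 0]])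
  show "(\<lambda>q. indicator S q * (normal_tail (g q) * std_normal_density q)) \<in> borel_measurable lborel"
    by measurable
  have "0 \<le> normal_tail x" "normal_tail x \<le> 1" for x
    by (simp_all add: normal_tail_def std_normal.cdf_bounded_prob std_normal.cdf_nonneg)
  then show "AE q in lborel. norm (indicator S q * (normal_tail (g q) * std_normal_density q)) \<le> norm (std_normal_density q)"
    by (auto simp: indicator_def abs_mult mult_left_le_one_le)
qed simp

lemma integral_std_normal_density_Iic:
  "(LINT q|lborel. indicator {..a} q * std_normal_density q) = std_normal_cdf a"
proof -
  have "std_normal_cdf a = (LINT x|std_normal_distribution. indicator {..a} x)"
    by (simp add: cdf_def)
  also have "\<dots> = (LINT q|lborel. std_normal_density q * indicator {..a} q)"
    by (subst integral_density) auto
  finally show ?thesis by (simp add: mult.commute)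
qed

lemma integral_std_normal_density_Ici:
  "(LINT q|lborel. indicator {a..} q * std_normal_density q) = normal_tail a"
proof -
  have int: "integrable lborel (\<lambda>q. indicator S q * std_normal_density q)" if "S \<in> sets borel" for S
    using integrable_mult_indicator[OF _ integrable_normal_density[of 1 0], of S] that by simp
  have "(LINT q|lborel. indicator {a..} q * std_normal_density q)
      = (LINT q|lborel. std_normal_density q - indicator {..a} q * std_normal_density q)"
    by (rule integral_cong_AE) (auto simp: indicator_def intro!: AE_I[where N="{a}"])
  also have "\<dots> = 1 - std_normal_cdf a"
    using int[of "{..a}"] by (simp add: integral_std_normal_density_Iic)
  finally show ?thesis by (simp add: normal_tail_def)
qed

text \<open>The antiderivative of \<open>q * std_normal_density q\<close> is \<open>- std_normal_density q\<close>.\<close>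
lemma integral_first_moment_std_normal_density_Ici:
  "(LINT q|lborel. indicator {a..} q * (q * std_normal_density q)) = std_normal_density a"
proof -
  have "integrable lborel (\<lambda>q. q * std_normal_density q)"
    using integrable_std_normal_moment[of 1] by (simp add: mult.commute)
  then have int: "set_integrable lborel {a<..} (\<lambda>q. q * std_normal_density q)"
    unfolding set_integrable_def by (intro integrable_mult_indicator) auto
  have "(LBINT q=ereal a..\<infinity>. q * std_normal_density q) = 0 - (- std_normal_density a)"
  proof (rule interval_integral_FTC_integrable[where F = "\<lambda>x. - std_normal_density x"])
    show "((\<lambda>x. - std_normal_density x) has_vector_derivative x * std_normal_density x) (at x)" for x
      by (auto simp: has_real_derivative_iff_has_vector_derivative[symmetric] intro!: derivative_eq_intros)
    show "isCont (\<lambda>q. q * std_normal_density q) x" for x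
      unfolding std_normal_density_def by (intro continuous_intros) auto
    have "((\<lambda>x. - std_normal_density x) \<longlongrightarrow> - std_normal_density a) (at_right a)"
      unfolding std_normal_density_def by (intro tendsto_intros) auto
    then show "(((\<lambda>x. - std_normal_density x) \<circ> real_of_ereal) \<longlongrightarrow> - std_normal_density a) (at_right (ereal a))"
      by (simp add: ereal_tendsto_simps)
    show "(((\<lambda>x. - std_normal_density x) \<circ> real_of_ereal) \<longlongrightarrow> 0) (at_left \<infinity>)"
      using tendsto_minus[OF std_normal_density_at_top] by (simp add: ereal_tendsto_simps)
  qed (use int in auto)
  then have "(LINT q|lborel. indicator {a<..} q * (q * std_normal_density q)) = std_normal_density a"
    by (simp add: interval_lebesgue_integral_def set_lebesgue_integral_def)
  moreover have "(LINT q|lborel. indicator {a..} q * (q * std_normal_density q))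
      = (LINT q|lborel. indicator {a<..} q * (q * std_normal_density q))"
    by (rule integral_cong_AE) (auto simp: indicator_def intro!: AE_I[where N="{a}"])
  ultimately show ?thesis by simp
qed

text \<open>
  The dominating function for the limit of the correction integral: with \<open>g x = x * mills_ratio x\<close>
  the quotient minus \<open>1\<close> is \<open>(g z * (r * t - z) + z * (g z - g t)) / (z * g t)\<close>. Here
  \<open>r * t - z = - \<sigma> * q\<close>, and \<open>g\<close> lies within \<open>4 / c\<^sup>2\<close> of \<open>1\<close> on \<open>{c / 2..}\<close>. The bound is
  uniform in \<open>c\<close> as long as \<open>c * \<sigma>\<close> stays bounded.
\<close>
lemma mills_ratio_quotient_bound:
  assumes "c \<ge> 4" "z \<ge> c / 2" "t \<ge> c / 2" "\<sigma> \<ge> 0" and z: "z = r * t + \<sigma> * q"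
  shows "c\<^sup>2 * \<bar>r * mills_ratio z / mills_ratio t - 1\<bar> \<le> 4 * (c * \<sigma>) * \<bar>q\<bar> + 8"
proof -
  have pos: "c > 0" "z > 0" "t > 0" using assms by auto
  define g where "g x = x * mills_ratio x" for x
  have g_le: "g x \<le> 1" and g_ge: "g x \<ge> 1 - 4 / c\<^sup>2" if "x \<ge> c / 2" for x
  proof -
    have "x > 0" using that pos by simp
    show "g x \<le> 1" using mills_ratio_upper[OF \<open>x > 0\<close>] by (simp add: g_def)
    have "(c / 2)\<^sup>2 \<le> x\<^sup>2" using that pos by (intro power_mono) auto
    then have "1 / x\<^sup>2 \<le> 1 / (c / 2)\<^sup>2" using pos \<open>x > 0\<close> by (intro divide_left_mono) auto
    then show "g x \<ge> 1 - 4 / c\<^sup>2"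
      using mills_ratio_lower[OF \<open>x > 0\<close>] by (simp add: g_def power_divide)
  qed
  have "4\<^sup>2 \<le> c\<^sup>2" using assms by (intro power_mono) auto
  then have "4 / c\<^sup>2 \<le> 1 / 2" using pos by (simp add: field_simps)
  then have half: "g x \<ge> 1 / 2" if "x \<ge> c / 2" for x using g_ge[OF that] by simp
  have mills: "mills_ratio x = g x / x" if "x > 0" for x using that by (simp add: g_def)
  have gt: "g t \<ge> 1 / 2" using half assms by blast
  have "r * mills_ratio z / mills_ratio t - 1 = (g z * (r * t - z) + z * (g z - g t)) / (z * g t)"
    using pos gt by (simp add: mills[OF pos(2)] mills[OF pos(3)] field_simps)
  also have "\<bar>\<dots>\<bar> \<le> (\<sigma> * \<bar>q\<bar> + z * (4 / c\<^sup>2)) / (z * (1 / 2))"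
    unfolding abs_divide
  proof (rule frac_le)
    have "\<bar>g z * (r * t - z)\<bar> \<le> 1 * \<bar>r * t - z\<bar>"
      unfolding abs_mult using g_le[of z] half[of z] assms by (intro mult_right_mono) auto
    moreover have "\<bar>r * t - z\<bar> = \<sigma> * \<bar>q\<bar>" using assms by (simp add: abs_mult)
    moreover have "\<bar>z * (g z - g t)\<bar> \<le> z * (4 / c\<^sup>2)"
      unfolding abs_mult using pos g_le[of z] g_ge[of z] g_le[of t] g_ge[of t] assms
      by (intro mult_mono) (auto simp: abs_le_iff)
    ultimately show "\<bar>g z * (r * t - z) + z * (g z - g t)\<bar> \<le> \<sigma> * \<bar>q\<bar> + z * (4 / c\<^sup>2)"
      using abs_triangle_ineq[of "g z * (r * t - z)" "z * (g z - g t)"] by linarith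
    show "z * (1 / 2) \<le> \<bar>z * g t\<bar>" using pos gt by (simp add: abs_mult)
  qed (use pos assms in auto)
  also have "\<dots> = 2 * (\<sigma> * \<bar>q\<bar> / z) + 8 / c\<^sup>2" using pos by (simp add: field_simps)
  also have "\<sigma> * \<bar>q\<bar> / z \<le> \<sigma> * \<bar>q\<bar> / (c / 2)"
    using assms pos by (intro divide_left_mono) auto
  finally have "c\<^sup>2 * \<bar>r * mills_ratio z / mills_ratio t - 1\<bar> \<le> c\<^sup>2 * (2 * (\<sigma> * \<bar>q\<bar> / (c / 2)) + 8 / c\<^sup>2)"
    by (intro mult_left_mono) auto
  also have "\<dots> = 4 * (c * \<sigma>) * \<bar>q\<bar> + 8" using pos by (simp add: field_simps power2_eq_square)
  finally show ?thesis .
qed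

section \<open>Bivariate Gaussian vectors\<close>

text \<open>
  Invariance of planar Lebesgue measure under rotations. If \<open>a \<noteq> 0\<close>, the rotation is reached
  by two one-dimensional affine substitutions with scale factors \<open>1 / a\<close> and \<open>a\<close>, which cancel;
  if \<open>a = 0\<close>, it is the exchange of the coordinates up to signs.
\<close>
lemma nn_integral_lborel_rotate:
  fixes a b :: real and h :: "real \<times> real \<Rightarrow> ennreal"
  assumes [measurable]: "h \<in> borel_measurable (borel \<Otimes>\<^sub>M borel)" and unit: "a\<^sup>2 + b\<^sup>2 = 1"
  shows "(\<integral>\<^sup>+w. \<integral>\<^sup>+z. h (z, w) \<partial>lborel \<partial>lborel)
       = (\<integral>\<^sup>+q. \<integral>\<^sup>+x. h (a * x - b * q, b * x + a * q) \<partial>lborel \<partial>lborel)"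
proof (cases "a = 0")
  case False
  have "(\<integral>\<^sup>+w. \<integral>\<^sup>+z. h (z, w) \<partial>lborel \<partial>lborel)
      = (\<integral>\<^sup>+w. \<integral>\<^sup>+x. ennreal \<bar>1 / a\<bar> * h (- (b / a) * w + 1 / a * x, w) \<partial>lborel \<partial>lborel)"
  proof (rule nn_integral_cong)
    fix w :: real
    show "(\<integral>\<^sup>+z. h (z, w) \<partial>lborel) = (\<integral>\<^sup>+x. ennreal \<bar>1 / a\<bar> * h (- (b / a) * w + 1 / a * x, w) \<partial>lborel)"
      using False by (subst nn_integral_real_affine[of _ "1 / a" "- (b / a) * w"]) (auto simp: nn_integral_cmult)
  qed
  also have "\<dots> = (\<integral>\<^sup>+x. \<integral>\<^sup>+w. ennreal \<bar>1 / a\<bar> * h (- (b / a) * w + 1 / a * x, w) \<partial>lborel \<partial>lborel)"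
    by (rule lborel_pair.Fubini') measurable
  also have "\<dots> = (\<integral>\<^sup>+x. \<integral>\<^sup>+q. h (a * x - b * q, b * x + a * q) \<partial>lborel \<partial>lborel)"
  proof (rule nn_integral_cong)
    fix x :: real
    have "(\<integral>\<^sup>+w. ennreal \<bar>1 / a\<bar> * h (- (b / a) * w + 1 / a * x, w) \<partial>lborel)
        = (\<integral>\<^sup>+q. ennreal \<bar>a\<bar> * (ennreal \<bar>1 / a\<bar> *
             h (- (b / a) * (b * x + a * q) + 1 / a * x, b * x + a * q)) \<partial>lborel)"
      using False by (subst nn_integral_real_affine[of _ a "b * x"]) (auto simp: nn_integral_cmult)
    also have "\<dots> = (\<integral>\<^sup>+q. h (a * x - b * q, b * x + a * q) \<partial>lborel)"
    proof (rule nn_integral_cong)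
      fix q :: real
      have "- (b / a) * (b * x + a * q) + 1 / a * x = (1 - b\<^sup>2) * x / a - b * q"
        using False by (simp add: field_simps power2_eq_square)
      also have "\<dots> = a * x - b * q"
      proof -
        have "1 - b\<^sup>2 = a\<^sup>2" using unit by linarith
        then show ?thesis using False by (simp add: power2_eq_square)
      qed
      finally show "ennreal \<bar>a\<bar> * (ennreal \<bar>1 / a\<bar> * h (- (b / a) * (b * x + a * q) + 1 / a * x, b * x + a * q))
          = h (a * x - b * q, b * x + a * q)"
        using False by (simp add: mult.assoc[symmetric] ennreal_mult[symmetric] abs_mult[symmetric])
    qed
    finally show "(\<integral>\<^sup>+w. ennreal \<bar>1 / a\<bar> * h (- (b / a) * w + 1 / a * x, w) \<partial>lborel)
        = (\<integral>\<^sup>+q. h (a * x - b * q, b * x + a * q) \<partial>lborel)" .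
  qed
  also have "\<dots> = (\<integral>\<^sup>+q. \<integral>\<^sup>+x. h (a * x - b * q, b * x + a * q) \<partial>lborel \<partial>lborel)"
    by (rule lborel_pair.Fubini') measurable
  finally show ?thesis .
next
  case True
  with unit have b: "\<bar>b\<bar> = 1" by (simp add: abs_square_eq_1)
  then have b0: "b \<noteq> 0" by auto
  have "(\<integral>\<^sup>+w. \<integral>\<^sup>+z. h (z, w) \<partial>lborel \<partial>lborel) = (\<integral>\<^sup>+w. \<integral>\<^sup>+q. h (- b * q, w) \<partial>lborel \<partial>lborel)"
    by (rule nn_integral_cong, subst nn_integral_real_affine[of _ "- b" 0]) (use b b0 in auto)
  also have "\<dots> = (\<integral>\<^sup>+x. \<integral>\<^sup>+q. h (- b * q, b * x) \<partial>lborel \<partial>lborel)"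
    by (subst nn_integral_real_affine[of _ b 0]) (use b b0 in auto)
  also have "\<dots> = (\<integral>\<^sup>+q. \<integral>\<^sup>+x. h (- b * q, b * x) \<partial>lborel \<partial>lborel)"
    by (rule lborel_pair.Fubini') measurable
  finally show ?thesis using True by simp
qed

text \<open>Rotational symmetry of the standard normal density in the plane.\<close>
lemma std_normal_density_mult:
  assumes "x\<^sup>2 + y\<^sup>2 = z\<^sup>2 + w\<^sup>2"
  shows "std_normal_density x * std_normal_density y = std_normal_density z * std_normal_density w"
proof -
  have "- x\<^sup>2 / 2 + - y\<^sup>2 / 2 = - z\<^sup>2 / 2 + - w\<^sup>2 / 2" using assms by simp
  then have "exp (- x\<^sup>2 / 2) * exp (- y\<^sup>2 / 2) = exp (- z\<^sup>2 / 2) * exp (- w\<^sup>2 / 2)"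
    unfolding exp_add[symmetric] by simp
  then show ?thesis unfolding std_normal_density_def by simp
qed

lemma nn_integral_std_normal_reflect:
  assumes [measurable]: "g \<in> borel_measurable borel"
  shows "(\<integral>\<^sup>+q. g (- q) \<partial>std_normal_distribution) = (\<integral>\<^sup>+q. g q \<partial>std_normal_distribution)"
  by (simp add: nn_integral_density, subst (2) nn_integral_real_affine[of _ "-1" 0])
     (auto simp: std_normal_density_def)

interpretation std_normal_pair: pair_prob_space std_normal_distribution std_normal_distribution ..

text \<open>
  Rotating the plane so that the first linear form becomes a coordinate turns the second form
  into \<open>r * x + d * q\<close>, where \<open>d\<close> is the determinant of the two coefficient vectors. By
  Lagrange's identity \<open>d\<^sup>2 = 1 - r\<^sup>2\<close>, and the sign of \<open>d\<close> is absorbed by reflecting \<open>q\<close>. The case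
  of linearly dependent forms (\<open>d = 0\<close>) is included.
\<close>
lemma nn_integral_std_normal_pair:
  fixes f :: "real \<times> real \<Rightarrow> ennreal"
  assumes [measurable]: "f \<in> borel_measurable (borel \<Otimes>\<^sub>M borel)"
    and "a1\<^sup>2 + a2\<^sup>2 = 1" and "b1\<^sup>2 + b2\<^sup>2 = 1"
    and r: "r = a1 * b1 + a2 * b2"
  shows "(\<integral>\<^sup>+p. f (a1 * fst p + a2 * snd p, b1 * fst p + b2 * snd p)
            \<partial>(std_normal_distribution \<Otimes>\<^sub>M std_normal_distribution))
       = (\<integral>\<^sup>+q. \<integral>\<^sup>+x. f (x, r * x + sqrt (1 - r\<^sup>2) * q)
            \<partial>std_normal_distribution \<partial>std_normal_distribution)"
proof -
  define d where "d = a1 * b2 - a2 * b1"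
  have "(a1\<^sup>2 + a2\<^sup>2) * (b1\<^sup>2 + b2\<^sup>2) = r\<^sup>2 + d\<^sup>2"
    unfolding r d_def by (simp add: power2_eq_square algebra_simps)
  then have "sqrt (1 - r\<^sup>2) = \<bar>d\<bar>" using assms by (simp add: real_sqrt_abs[symmetric] del: real_sqrt_abs)
  then have d: "sqrt (1 - r\<^sup>2) = d \<or> sqrt (1 - r\<^sup>2) = - d" by auto
  let ?N = "std_normal_distribution"
  let ?\<phi> = std_normal_density
  have "(\<integral>\<^sup>+p. f (a1 * fst p + a2 * snd p, b1 * fst p + b2 * snd p) \<partial>(?N \<Otimes>\<^sub>M ?N))
     = (\<integral>\<^sup>+w. \<integral>\<^sup>+z. f (a1 * z + a2 * w, b1 * z + b2 * w) \<partial>?N \<partial>?N)"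
    by (subst std_normal_pair.nn_integral_snd[symmetric]) auto
  also have "\<dots> = (\<integral>\<^sup>+w. \<integral>\<^sup>+z. (\<lambda>(z, w). ennreal (?\<phi> w * ?\<phi> z) *
       f (a1 * z + a2 * w, b1 * z + b2 * w)) (z, w) \<partial>lborel \<partial>lborel)"
    by (simp add: nn_integral_density nn_integral_cmult[symmetric] ennreal_mult mult.assoc)
  also have "\<dots> = (\<integral>\<^sup>+q. \<integral>\<^sup>+x. (\<lambda>(z, w). ennreal (?\<phi> w * ?\<phi> z) *
       f (a1 * z + a2 * w, b1 * z + b2 * w)) (a1 * x - a2 * q, a2 * x + a1 * q) \<partial>lborel \<partial>lborel)"
    by (rule nn_integral_lborel_rotate) (use assms in \<open>simp_all add: case_prod_beta\<close>)
  also have "\<dots> = (\<integral>\<^sup>+q. \<integral>\<^sup>+x. ennreal (?\<phi> q * ?\<phi> x) * f (x, r * x + d * q) \<partial>lborel \<partial>lborel)"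
  proof (intro nn_integral_cong)
    fix q x :: real
    have "(a1 * x - a2 * q)\<^sup>2 + (a2 * x + a1 * q)\<^sup>2 = (a1\<^sup>2 + a2\<^sup>2) * (x\<^sup>2 + q\<^sup>2)"
      by (simp add: power2_eq_square algebra_simps)
    then have "?\<phi> (a2 * x + a1 * q) * ?\<phi> (a1 * x - a2 * q) = ?\<phi> q * ?\<phi> x"
      using assms by (intro std_normal_density_mult) simp
    moreover have "a1 * (a1 * x - a2 * q) + a2 * (a2 * x + a1 * q) = (a1\<^sup>2 + a2\<^sup>2) * x"
      by (simp add: power2_eq_square algebra_simps)
    moreover have "b1 * (a1 * x - a2 * q) + b2 * (a2 * x + a1 * q) = r * x + d * q"
      by (simp add: d_def r algebra_simps)
    ultimately show "(\<lambda>(z, w). ennreal (?\<phi> w * ?\<phi> z) *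
       f (a1 * z + a2 * w, b1 * z + b2 * w)) (a1 * x - a2 * q, a2 * x + a1 * q)
       = ennreal (?\<phi> q * ?\<phi> x) * f (x, r * x + d * q)"
      using assms by simp
  qed
  also have "\<dots> = (\<integral>\<^sup>+q. \<integral>\<^sup>+x. f (x, r * x + d * q) \<partial>?N \<partial>?N)"
    by (simp add: nn_integral_density nn_integral_cmult[symmetric] ennreal_mult mult.assoc)
  also have "\<dots> = (\<integral>\<^sup>+q. \<integral>\<^sup>+x. f (x, r * x + sqrt (1 - r\<^sup>2) * q) \<partial>?N \<partial>?N)"
    using d nn_integral_std_normal_reflect[of "\<lambda>q. \<integral>\<^sup>+x. f (x, r * x + d * q) \<partial>?N"] by auto
  finally show ?thesis .
qed

lemma std_normal_pair_moment:
  assumes "integrable std_normal_distribution f" "integrable std_normal_distribution g"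
  shows "has_bochner_integral (std_normal_distribution \<Otimes>\<^sub>M std_normal_distribution)
     (\<lambda>p. f (fst p) * g (snd p))
     ((LINT z|std_normal_distribution. f z) * (LINT w|std_normal_distribution. g w :: real))"
proof -
  have [measurable]: "f \<in> borel_measurable borel" "g \<in> borel_measurable borel"
    using assms[THEN borel_measurable_integrable] by simp_all
  have "integrable (std_normal_distribution \<Otimes>\<^sub>M std_normal_distribution) (\<lambda>p. f (fst p) * g (snd p))"
    by (rule std_normal_pair.Fubini_integrable) (use assms in \<open>auto simp: abs_mult\<close>)
  then show ?thesis
    by (auto simp: has_bochner_integral_iff std_normal_pair.integral_fst'[symmetric])
qed

text \<open>
  Second moments of affine forms in two independent standard normal variables. Taking one of
  the forms constant \<open>1\<close> yields the first moments as well.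
\<close>
lemma std_normal_pair_affine_product:
  "has_bochner_integral (std_normal_distribution \<Otimes>\<^sub>M std_normal_distribution)
     (\<lambda>(z, w). (m + a1 * z + a2 * w) * (k + b1 * z + b2 * w)) (m * k + a1 * b1 + a2 * b2)"
proof -
  let ?N = "std_normal_distribution"
  have i: "integrable ?N (\<lambda>x. x)" "integrable ?N (\<lambda>x. x\<^sup>2)"
    using integrable_std_normal_distribution_moment[of 1] integrable_std_normal_distribution_moment[of 2]
    by simp_all
  have e: "(LINT x|?N. x) = 0" "(LINT x|?N. x\<^sup>2) = 1"
    using integral_std_normal_distribution_moment_odd[of 1] std_normal_distribution_even_moments(1)[of 1]
    by simp_all
  have one: "std_normal.prob UNIV = 1" using std_normal.prob_space by simp
  have "has_bochner_integral (?N \<Otimes>\<^sub>M ?N)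
     (\<lambda>p. (m * k) * (1 * 1) + (a1 * k + m * b1) * (fst p * 1) + (m * b2 + a2 * k) * (1 * snd p) + (a1 * b1) * ((fst p)\<^sup>2 * 1)
        + (a2 * b2) * (1 * (snd p)\<^sup>2) + (a1 * b2 + a2 * b1) * (fst p * snd p))
     ((m * k) * (1 * 1) + (a1 * k + m * b1) * (0 * 1) + (m * b2 + a2 * k) * (1 * 0) + (a1 * b1) * (1 * 1)
        + (a2 * b2) * (1 * 1) + (a1 * b2 + a2 * b1) * (0 * 0))"
    by (intro has_bochner_integral_add has_bochner_integral_mult_right)
       (use std_normal_pair_moment[of "\<lambda>_. 1" "\<lambda>_. 1"] std_normal_pair_moment[of "\<lambda>x. x" "\<lambda>_. 1"]
         std_normal_pair_moment[of "\<lambda>_. 1" "\<lambda>x. x"] std_normal_pair_moment[of "\<lambda>x. x\<^sup>2" "\<lambda>_. 1"]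
         std_normal_pair_moment[of "\<lambda>_. 1" "\<lambda>x. x\<^sup>2"] std_normal_pair_moment[of "\<lambda>x. x" "\<lambda>x. x"]
       in \<open>simp_all add: i e one\<close>)
  then show ?thesis
    by (rule has_bochner_integral_cong[THEN iffD1, rotated -1])
       (auto simp: algebra_simps power2_eq_square)
qed

text \<open>
  The moment conditions determine the coefficients of the affine image: the translation part
  vanishes, and the coefficient vectors are unit vectors with inner product \<open>r\<close>.
\<close>
lemma (in prob_space) standard_bivariate_gaussian_distr:
  assumes "standard_bivariate_gaussian X Y" and r: "correlation X Y = r"
  obtains a1 a2 b1 b2 where "a1\<^sup>2 + a2\<^sup>2 = 1" "b1\<^sup>2 + b2\<^sup>2 = 1" "r = a1 * b1 + a2 * b2"
    "distr M borel (\<lambda>\<omega>. (X \<omega>, Y \<omega>)) =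
        distr (std_normal_distribution \<Otimes>\<^sub>M std_normal_distribution) borel
          (\<lambda>p. (a1 * fst p + a2 * snd p, b1 * fst p + b2 * snd p))"
proof -
  let ?P = "std_normal_distribution \<Otimes>\<^sub>M std_normal_distribution"
  obtain m k a1 a2 b1 b2 where
    d: "distr M borel (\<lambda>\<omega>. (X \<omega>, Y \<omega>)) = distr ?P borel
          (\<lambda>(z, w). (m + a1 * z + a2 * w, k + b1 * z + b2 * w))"
    and X[measurable]: "random_variable borel X" and Y[measurable]: "random_variable borel Y"
    and E: "expectation X = 0" "expectation Y = 0" "variance X = 1" "variance Y = 1"
    using assms(1) unfolding standard_bivariate_gaussian_def bivariate_gaussian_def by blast
  have ex: "expectation (\<lambda>\<omega>. (c * X \<omega> + c' * Y \<omega> + c'') * (e * X \<omega> + e' * Y \<omega> + e''))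
     = (c * m + c' * k + c'') * (e * m + e' * k + e'') + (c * a1 + c' * b1) * (e * a1 + e' * b1)
       + (c * a2 + c' * b2) * (e * a2 + e' * b2)" for c c' c'' e e' e'' :: real
  proof -
    let ?f = "\<lambda>(x, y). (c * x + c' * y + c'') * (e * x + e' * y + e'')"
    have [measurable]: "?f \<in> borel_measurable (borel :: (real \<times> real) measure)"
      by (simp add: borel_prod[symmetric])
    have "expectation (\<lambda>\<omega>. (c * X \<omega> + c' * Y \<omega> + c'') * (e * X \<omega> + e' * Y \<omega> + e''))
      = (LINT p|distr M borel (\<lambda>\<omega>. (X \<omega>, Y \<omega>)). ?f p)"
      by (subst integral_distr) auto
    also have "\<dots> = (LINT p|?P. ?f ((\<lambda>(z, w). (m + a1 * z + a2 * w, k + b1 * z + b2 * w)) p))"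
      unfolding d by (subst integral_distr) (auto simp: borel_prod[symmetric])
    also have "\<dots> = (LINT p|?P. (\<lambda>(z, w).
        ((c * m + c' * k + c'') + (c * a1 + c' * b1) * z + (c * a2 + c' * b2) * w) *
        ((e * m + e' * k + e'') + (e * a1 + e' * b1) * z + (e * a2 + e' * b2) * w)) p)"
      by (rule Bochner_Integration.integral_cong) (auto simp: algebra_simps)
    finally show ?thesis
      using std_normal_pair_affine_product[THEN has_bochner_integral_integral_eq] by simp
  qed
  have mk: "m = 0" "k = 0"
    using ex[of 1 0 0 0 0 1] ex[of 0 1 0 0 0 1] E by simp_all
  have "a1\<^sup>2 + a2\<^sup>2 = 1" "b1\<^sup>2 + b2\<^sup>2 = 1"
    using ex[of 1 0 0 1 0 0] ex[of 0 1 0 0 1 0] E mk by (simp_all add: power2_eq_square)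
  moreover have "r = a1 * b1 + a2 * b2"
    using ex[of 1 0 0 0 1 0] E mk r by (simp add: correlation_def)
  ultimately show thesis
    by (intro that[of a1 a2 b1 b2]) (use d mk in \<open>simp_all add: case_prod_beta'\<close>)
qed

text \<open>
  The marginal law of \<open>Y\<close> is obtained by using \<open>Y\<close> instead of \<open>X\<close> as the first coordinate of
  the rotated plane.
\<close>
lemma (in prob_space)
  assumes XY: "standard_bivariate_gaussian X Y" and r: "correlation X Y = r"
  shows standard_bivariate_gaussian_emeasure:
      "S \<in> sets (borel \<Otimes>\<^sub>M borel) \<Longrightarrow> emeasure M {\<omega> \<in> space M. (X \<omega>, Y \<omega>) \<in> S} =
        (\<integral>\<^sup>+q. \<integral>\<^sup>+x. indicator S (x, r * x + sqrt (1 - r\<^sup>2) * q)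
          \<partial>std_normal_distribution \<partial>std_normal_distribution)"
    and standard_bivariate_gaussian_marginal:
      "prob {\<omega> \<in> space M. Y \<omega> \<le> t} = std_normal_cdf t"
proof -
  let ?N = "std_normal_distribution"
  obtain a1 a2 b1 b2 where a: "a1\<^sup>2 + a2\<^sup>2 = 1" and b: "b1\<^sup>2 + b2\<^sup>2 = 1"
    and rab: "r = a1 * b1 + a2 * b2"
    and d: "distr M borel (\<lambda>\<omega>. (X \<omega>, Y \<omega>)) = distr (?N \<Otimes>\<^sub>M ?N) borel
          (\<lambda>p. (a1 * fst p + a2 * snd p, b1 * fst p + b2 * snd p))"
    using standard_bivariate_gaussian_distr[OF XY r] by blast
  have [measurable]: "random_variable borel X" "random_variable borel Y"
    using XY by (auto simp: standard_bivariate_gaussian_def bivariate_gaussian_def)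
  have *: "emeasure M {\<omega> \<in> space M. (X \<omega>, Y \<omega>) \<in> S} =
      (\<integral>\<^sup>+p. indicator S (a1 * fst p + a2 * snd p, b1 * fst p + b2 * snd p) \<partial>(?N \<Otimes>\<^sub>M ?N))"
    if [measurable]: "S \<in> sets (borel \<Otimes>\<^sub>M borel)" for S
  proof -
    have S: "S \<in> sets borel" using that by (simp only: borel_prod)
    have "emeasure M {\<omega> \<in> space M. (X \<omega>, Y \<omega>) \<in> S} = emeasure (distr M borel (\<lambda>\<omega>. (X \<omega>, Y \<omega>))) S"
      using S by (subst emeasure_distr) (auto intro!: arg_cong[where f="emeasure M"])
    also have "\<dots> = (\<integral>\<^sup>+p. indicator S p \<partial>distr (?N \<Otimes>\<^sub>M ?N) borel
          (\<lambda>p. (a1 * fst p + a2 * snd p, b1 * fst p + b2 * snd p)))"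
      using S by (simp add: d)
    also have "\<dots> = (\<integral>\<^sup>+p. indicator S (a1 * fst p + a2 * snd p, b1 * fst p + b2 * snd p) \<partial>(?N \<Otimes>\<^sub>M ?N))"
      using S by (subst nn_integral_distr) (auto simp: borel_prod[symmetric])
    finally show ?thesis .
  qed
  show "emeasure M {\<omega> \<in> space M. (X \<omega>, Y \<omega>) \<in> S} =
        (\<integral>\<^sup>+q. \<integral>\<^sup>+x. indicator S (x, r * x + sqrt (1 - r\<^sup>2) * q) \<partial>?N \<partial>?N)"
    if "S \<in> sets (borel \<Otimes>\<^sub>M borel)"
    unfolding *[OF that]
    by (rule nn_integral_std_normal_pair[OF _ a b rab]) (use that in simp)
  have "{\<omega> \<in> space M. Y \<omega> \<le> t} = {\<omega> \<in> space M. (X \<omega>, Y \<omega>) \<in> UNIV \<times> {..t}}" by auto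
  then have "emeasure M {\<omega> \<in> space M. Y \<omega> \<le> t} =
    (\<integral>\<^sup>+p. (\<lambda>p. indicator {..t} (fst p)) (b1 * fst p + b2 * snd p, a1 * fst p + a2 * snd p) \<partial>(?N \<Otimes>\<^sub>M ?N))"
    using *[of "UNIV \<times> {..t}"] by (simp add: indicator_def)
  also have "\<dots> = (\<integral>\<^sup>+q. \<integral>\<^sup>+x. indicator {..t} (fst (x, r * x + sqrt (1 - r\<^sup>2) * q)) \<partial>?N \<partial>?N)"
    by (rule nn_integral_std_normal_pair[OF _ b a]) (simp_all add: rab)
  also have "\<dots> = emeasure ?N {..t}"
    using std_normal.emeasure_space_1 by simp
  finally show "prob {\<omega> \<in> space M. Y \<omega> \<le> t} = std_normal_cdf t"
    by (simp add: measure_def cdf_def)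
qed

text \<open>
  Integrating over the first coordinate \<open>x\<close> for fixed \<open>q\<close> gives the probability of
  \<open>X > s, Y \<le> t\<close> as the integral over \<open>q \<le> A\<close> of
  \<open>(normal_tail s - normal_tail ((t - \<sigma> * q) / r)) * std_normal_density q\<close>. The substitution
  \<open>q \<mapsto> \<sigma> * t - r * q\<close> moves the second part to \<open>q \<ge> B\<close> and takes \<open>(t - \<sigma> * q) / r\<close> to
  \<open>r * t + \<sigma> * q\<close>. Since \<open>(r * t + \<sigma> * q, \<sigma> * t - r * q)\<close> and \<open>(t, q)\<close> have the same norm,
  \<open>std_normal_density t\<close>, and with it \<open>normal_tail t\<close>, can be taken out of the integral.
  Subtracting \<open>1\<close> from the quotient of Mills ratios isolates the part of the integrand that
  is small in the asymptotic regime.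
\<close>
lemma (in prob_space) joint_cdf_standard_bivariate_gaussian:
  fixes r s t :: real
  assumes XY: "standard_bivariate_gaussian X Y" and r: "correlation X Y = r" "0 < r" "r < 1"
  defines "\<sigma> \<equiv> sqrt (1 - r\<^sup>2)"
  defines "A \<equiv> (t - r * s) / \<sigma>" and "B \<equiv> (s - r * t) / \<sigma>"
  shows "1 - joint_cdf X Y s t = normal_tail s * std_normal_cdf A + normal_tail t *
    (std_normal_cdf B - (LINT q|lborel. indicator {B..} q *
       ((r * mills_ratio (r * t + \<sigma> * q) / mills_ratio t - 1) * std_normal_density q)))"
proof -
  let ?N = std_normal_distribution
  let ?\<phi> = std_normal_density
  have "r\<^sup>2 < 1" using r by (simp add: abs_square_less_1)
  then have \<sigma>: "\<sigma> > 0" and \<sigma>2: "\<sigma>\<^sup>2 = 1 - r\<^sup>2" by (simp_all add: \<sigma>_def)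
  have [measurable]: "random_variable borel X" "random_variable borel Y"
    using XY by (auto simp: standard_bivariate_gaussian_def bivariate_gaussian_def)
  define f where "f q = indicator {..A} q * (normal_tail s * ?\<phi> q)
      - indicator {..A} q * (normal_tail ((t - \<sigma> * q) / r) * ?\<phi> q)" for q
  have int: "integrable lborel f"
    unfolding f_def using integrable_density_times_normal_tail[of "\<lambda>_. s" "{..A}"]
      integrable_density_times_normal_tail[of "\<lambda>q. (t - \<sigma> * q) / r" "{..A}"]
    by (intro Bochner_Integration.integrable_diff) simp_all
  have inner: "ennreal (?\<phi> q) * emeasure ?N {s<..(t - \<sigma> * q) / r} = ennreal (f q)" for q
  proof (cases "q \<le> A")
    case True
    then have le: "s \<le> (t - \<sigma> * q) / r" using \<sigma> r by (simp add: A_def field_simps)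
    have "emeasure ?N {s<..(t - \<sigma> * q) / r} = ennreal (normal_tail s - normal_tail ((t - \<sigma> * q) / r))"
      using std_normal.cdf_diff_eq[of s "(t - \<sigma> * q) / r"] le
      by (cases "s = (t - \<sigma> * q) / r")
         (auto simp: std_normal.emeasure_eq_measure normal_tail_def)
    then show ?thesis
      using True le std_normal.cdf_nondecreasing[OF le]
      by (simp add: f_def ennreal_mult[symmetric] normal_tail_def algebra_simps)
  next
    case False
    then have "\<not> s \<le> (t - \<sigma> * q) / r" using \<sigma> r by (simp add: A_def field_simps)
    then have "{s<..(t - \<sigma> * q) / r} = {}" by auto
    with False show ?thesis by (simp add: f_def)
  qed
  have f_nonneg: "f q \<ge> 0" for q
  proof (cases "q \<le> A")
    case True
    then have le: "s \<le> (t - \<sigma> * q) / r" using \<sigma> r by (simp add: A_def field_simps)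
    then show ?thesis using True std_normal.cdf_nondecreasing[OF le]
      by (simp add: f_def normal_tail_def mult_right_mono)
  qed (simp add: f_def)
  have "emeasure M {\<omega> \<in> space M. X \<omega> > s \<and> Y \<omega> \<le> t} =
     emeasure M {\<omega> \<in> space M. (X \<omega>, Y \<omega>) \<in> {s<..} \<times> {..t}}"
    by (rule arg_cong[where f="emeasure M"]) auto
  also have "\<dots> = (\<integral>\<^sup>+q. \<integral>\<^sup>+x. indicator ({s<..} \<times> {..t}) (x, r * x + \<sigma> * q) \<partial>?N \<partial>?N)"
    unfolding \<sigma>_def by (rule standard_bivariate_gaussian_emeasure[OF XY r(1)]) simp
  also have "\<dots> = (\<integral>\<^sup>+q. \<integral>\<^sup>+x. indicator {s<..(t - \<sigma> * q) / r} x \<partial>?N \<partial>?N)"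
    using r by (intro nn_integral_cong) (auto simp: indicator_def field_simps)
  also have "\<dots> = (\<integral>\<^sup>+q. emeasure ?N {s<..(t - \<sigma> * q) / r} \<partial>?N)"
    by simp
  also have "\<dots> = (\<integral>\<^sup>+q. ennreal (?\<phi> q) * emeasure ?N {s<..(t - \<sigma> * q) / r} \<partial>lborel)"
  proof (rule nn_integral_density)
    have "(\<lambda>q. \<integral>\<^sup>+x. indicator {p. s < snd p \<and> snd p \<le> (t - \<sigma> * fst p) / r} (q, x) \<partial>?N) \<in> borel_measurable lborel"
      by measurable
    moreover have "indicator {p. s < snd p \<and> snd p \<le> (t - \<sigma> * fst p) / r} (q, x)
         = (indicator {s<..(t - \<sigma> * q) / r} x :: ennreal)" for q x
      by (auto simp: indicator_def)
    ultimately show "(\<lambda>q. emeasure ?N {s<..(t - \<sigma> * q) / r}) \<in> borel_measurable lborel"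
      by simp
  qed measurable
  also have "\<dots> = ennreal (integral\<^sup>L lborel f)"
    using int f_nonneg by (simp add: inner nn_integral_eq_integral)
  finally have P: "prob {\<omega> \<in> space M. X \<omega> > s \<and> Y \<omega> \<le> t} = integral\<^sup>L lborel f"
    using f_nonneg by (simp add: measure_def integral_nonneg)
  have "\<sigma> * t - r * q \<le> A \<longleftrightarrow> B \<le> q" for q
  proof -
    have "\<sigma> * t - r * q \<le> A \<longleftrightarrow> \<sigma>\<^sup>2 * t - r * q * \<sigma> \<le> t - r * s"
      using \<sigma> by (simp add: A_def field_simps power2_eq_square)
    also have "\<dots> \<longleftrightarrow> r * (s - r * t) \<le> r * (q * \<sigma>)"
      unfolding \<sigma>2 by (simp add: algebra_simps power2_eq_square)
    also have "\<dots> \<longleftrightarrow> s - r * t \<le> q * \<sigma>" using r by simp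
    also have "\<dots> \<longleftrightarrow> B \<le> q" using \<sigma> by (simp add: B_def field_simps)
    finally show ?thesis .
  qed
  then have ind: "indicator {..A} (\<sigma> * t - r * q) = (indicator {B..} q :: real)" for q
    by (simp add: indicator_def)
  have sub: "(t - \<sigma> * (\<sigma> * t - r * q)) / r = r * t + \<sigma> * q" for q
  proof -
    have "t - \<sigma> * (\<sigma> * t - r * q) = t - \<sigma>\<^sup>2 * t + \<sigma> * r * q" by (simp add: algebra_simps power2_eq_square)
    then show ?thesis unfolding \<sigma>2 using r by (simp add: field_simps power2_eq_square)
  qed
  have prod: "normal_tail (r * t + \<sigma> * q) * ?\<phi> (\<sigma> * t - r * q)
     = normal_tail t * (mills_ratio (r * t + \<sigma> * q) / mills_ratio t * ?\<phi> q)" for q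
  proof -
    have "(r * t + \<sigma> * q)\<^sup>2 + (\<sigma> * t - r * q)\<^sup>2 = (r\<^sup>2 + \<sigma>\<^sup>2) * (t\<^sup>2 + q\<^sup>2)"
      by (simp add: power2_eq_square algebra_simps)
    then have "?\<phi> (r * t + \<sigma> * q) * ?\<phi> (\<sigma> * t - r * q) = ?\<phi> t * ?\<phi> q"
      unfolding \<sigma>2 by (intro std_normal_density_mult) simp
    moreover have "mills_ratio t \<noteq> 0"
      using normal_tail_pos[of t] by (auto simp: normal_tail_eq_mills)
    ultimately show ?thesis unfolding normal_tail_eq_mills by (simp add: mult.assoc)
  qed
  define g where "g q = indicator {..A} q * (normal_tail ((t - \<sigma> * q) / r) * ?\<phi> q)" for q
  define h where "h q = indicator {B..} q * (r * mills_ratio (r * t + \<sigma> * q) / mills_ratio t * ?\<phi> q)" for q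
  have g: "integrable lborel g"
    unfolding g_def by (rule integrable_density_times_normal_tail) simp_all
  have gh: "normal_tail t * h q = r * g (\<sigma> * t + (- r) * q)" for q
    using sub[of q] prod[of q] ind[of q] by (simp add: g_def h_def)
  have "integrable lborel (\<lambda>q. normal_tail t * h q)"
    unfolding gh by (intro integrable_mult_right lborel_integrable_real_affine[OF g]) (use r in auto)
  then have h: "integrable lborel h"
    using normal_tail_pos[of t] by simp
  have "normal_tail t * integral\<^sup>L lborel h = (LINT q|lborel. r * g (\<sigma> * t + (- r) * q))"
    unfolding gh[symmetric] by simp
  also have "\<dots> = integral\<^sup>L lborel g"
    using lborel_integral_real_affine[of "- r" g "\<sigma> * t"] r by simp
  finally have gh': "integral\<^sup>L lborel g = normal_tail t * integral\<^sup>L lborel h" by simp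
  have "integral\<^sup>L lborel f = normal_tail s * std_normal_cdf A - integral\<^sup>L lborel g"
    unfolding f_def g_def[symmetric] using g integrable_density_times_normal_tail[of "\<lambda>_. s" "{..A}"]
    by (subst Bochner_Integration.integral_diff)
       (simp_all add: mult.left_commute[of "indicator _ _"] integral_std_normal_density_Iic)
  then have f': "integral\<^sup>L lborel f = normal_tail s * std_normal_cdf A - normal_tail t * integral\<^sup>L lborel h"
    using gh' by simp
  have i: "integrable lborel (\<lambda>q. indicator {B..} q * ?\<phi> q)"
    using integrable_mult_indicator[OF _ integrable_normal_density[of 1 0], of "{B..}"] by simp
  have "(LINT q|lborel. indicator {B..} q *
       ((r * mills_ratio (r * t + \<sigma> * q) / mills_ratio t - 1) * ?\<phi> q))
     = (LINT q|lborel. h q - indicator {B..} q * ?\<phi> q)"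
    by (rule Bochner_Integration.integral_cong) (auto simp: h_def algebra_simps)
  also have "\<dots> = integral\<^sup>L lborel h - normal_tail B"
    using h i by (simp add: integral_std_normal_density_Ici)
  finally have Q: "integral\<^sup>L lborel h = 1 - std_normal_cdf B + (LINT q|lborel. indicator {B..} q *
       ((r * mills_ratio (r * t + \<sigma> * q) / mills_ratio t - 1) * ?\<phi> q))"
    by (simp add: normal_tail_def)
  have "{\<omega> \<in> space M. Y \<omega> \<le> t} =
      {\<omega> \<in> space M. X \<omega> \<le> s \<and> Y \<omega> \<le> t} \<union> {\<omega> \<in> space M. X \<omega> > s \<and> Y \<omega> \<le> t}" by auto
  then have "prob {\<omega> \<in> space M. Y \<omega> \<le> t} =
      joint_cdf X Y s t + prob {\<omega> \<in> space M. X \<omega> > s \<and> Y \<omega> \<le> t}"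
    by (simp only: joint_cdf_def) (rule finite_measure_Union, auto)
  then have "1 - joint_cdf X Y s t = normal_tail t + integral\<^sup>L lborel f"
    using standard_bivariate_gaussian_marginal[OF XY r(1), of t] P by (simp add: normal_tail_def)
  also have "\<dots> = normal_tail s * std_normal_cdf A + normal_tail t * (1 - integral\<^sup>L lborel h)"
    using f' by (simp add: algebra_simps)
  finally show ?thesis unfolding Q by simp
qed

section \<open>Correlations in the Huesler-Reiss regime\<close>

text \<open>
  Here \<open>L n\<close> plays the role of \<open>\<lambda>\<^sub>n\<close>, and the correlation \<open>r n\<close> is recovered from it by solving
  \<open>(L n)\<^sup>2 = w n * (1 - r n) / 2\<close>. Since \<open>L n\<close> tends to \<open>lam > 0\<close>, the correlations lie strictly
  between \<open>0\<close> and \<open>1\<close> from some index on, which excludes the degenerate laws.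
\<close>
locale husler_reiss_regime =
  fixes b L :: "nat \<Rightarrow> real" and lam \<tau> :: real
  assumes b: "filterlim b at_top sequentially"
    and L: "expands (\<lambda>n. (b n)\<^sup>2) L lam (- \<tau>)"
    and lam: "lam > 0"
begin

abbreviation w :: "nat \<Rightarrow> real" where "w n \<equiv> (b n)\<^sup>2"

definition r :: "nat \<Rightarrow> real" where "r n = 1 - 2 * (L n)\<^sup>2 / w n"

definition \<sigma> :: "nat \<Rightarrow> real" where "\<sigma> n = sqrt (1 - (r n)\<^sup>2)"

text \<open>At \<open>v = ln x\<close> this is \<open>b n * x powr (1 / w n)\<close>.\<close>
definition level :: "real \<Rightarrow> nat \<Rightarrow> real" where "level v n = b n * exp (v / w n)"

text \<open>
  The arguments \<open>A\<close> and \<open>B\<close> of the exact formula are \<open>threshold u v n\<close> and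
  \<open>threshold v u n\<close>.
\<close>
definition threshold :: "real \<Rightarrow> real \<Rightarrow> nat \<Rightarrow> real" where
  "threshold u v n = (level v n - r n * level u n) / \<sigma> n"

lemma w_at_top: "filterlim w at_top sequentially"
  using L by (simp add: expands_def)

lemma eventually_b_gt: "eventually (\<lambda>n. b n > c) sequentially"
  using filterlim_at_top_dense[THEN iffD1, OF b] by blast

lemma expands_level: "expands w (\<lambda>n. level v n / b n) 1 v"
  by (rule expands_cong[OF expands_exp[OF w_at_top]])
     (use eventually_b_gt[of 0] in \<open>auto elim!: eventually_mono simp: level_def\<close>)

lemma expands_L_squared: "expands w (\<lambda>n. (L n)\<^sup>2) (lam\<^sup>2) (- 2 * lam * \<tau>)"
  using expands_mult[OF L L] by (simp add: power2_eq_square algebra_simps)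

lemma expands_r: "expands w r 1 (- 2 * lam\<^sup>2)"
  unfolding r_def[abs_def]
  using expands_diff[OF expands_const[OF w_at_top, of 1] expands_vanishing[OF w_at_top,
    of "\<lambda>n. 2 * (L n)\<^sup>2" "2 * lam\<^sup>2"]] expands_tendsto[OF expands_L_squared]
  by (auto intro: tendsto_intros)

lemma expands_L_squared_over_w: "expands w (\<lambda>n. (L n)\<^sup>2 / w n) 0 (lam\<^sup>2)"
  by (rule expands_vanishing[OF w_at_top expands_tendsto[OF expands_L_squared]])

text \<open>
  With \<open>y = (L n)\<^sup>2 / w n\<close> one has \<open>r n = 1 - 2 * y\<close>, hence \<open>(\<sigma> n)\<^sup>2 = 4 * y * (1 - y)\<close>, and
  \<open>y \<longlongrightarrow> 0\<close>.
\<close>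
lemma eventually_regime:
  "eventually (\<lambda>n. b n > 4 \<and> L n > 0 \<and> 0 < r n \<and> r n < 1 \<and> \<sigma> n > 0 \<and>
     b n * \<sigma> n = 2 * L n * sqrt (1 - (L n)\<^sup>2 / w n)) sequentially"
proof -
  have "eventually (\<lambda>n. (L n)\<^sup>2 / w n < 1 / 2) sequentially" "eventually (\<lambda>n. L n > 0) sequentially"
    using order_tendstoD(2)[OF expands_tendsto[OF expands_L_squared_over_w], of "1 / 2"]
      order_tendstoD(1)[OF expands_tendsto[OF L] lam] by auto
  with eventually_b_gt[of 4] show ?thesis
  proof eventually_elim
    case (elim n)
    define y where "y = (L n)\<^sup>2 / w n"
    have r: "r n = 1 - 2 * y" by (simp add: r_def y_def)
    have y: "0 < y" "y < 1 / 2" using elim by (auto simp: y_def)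
    have "1 - (r n)\<^sup>2 = 4 * y * (1 - y)" unfolding r by (simp add: power2_eq_square algebra_simps)
    then have \<sigma>: "\<sigma> n = sqrt (4 * y * (1 - y))" by (simp add: \<sigma>_def)
    also have "\<dots> = 2 * sqrt y * sqrt (1 - y)"
      by (simp add: real_sqrt_mult)
    also have "sqrt y = L n / b n" using elim by (simp add: y_def real_sqrt_divide)
    finally have "b n * \<sigma> n = 2 * L n * sqrt (1 - y)" using elim by simp
    moreover have "\<sigma> n > 0" unfolding \<sigma> using y by simp
    ultimately show ?case using elim y r by (simp add: y_def)
  qed
qed

lemma expands_b_sigma: "expands w (\<lambda>n. b n * \<sigma> n) (2 * lam) (- 2 * \<tau> - lam ^ 3)"
proof -
  have "expands w (\<lambda>n. 1 - (L n)\<^sup>2 / w n) (1 - 0) (0 - lam\<^sup>2)"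
    by (intro expands_diff expands_const expands_L_squared_over_w w_at_top)
  then have "expands w (\<lambda>n. sqrt (1 - (L n)\<^sup>2 / w n)) (sqrt 1) (inverse (sqrt 1) / 2 * (- lam\<^sup>2))"
    by (intro expands_compose DERIV_real_sqrt) simp_all
  from expands_mult[OF expands_cmult[OF L, of 2] this]
  have "expands w (\<lambda>n. 2 * L n * sqrt (1 - (L n)\<^sup>2 / w n)) (2 * lam) (- 2 * \<tau> - lam ^ 3)"
    by (simp add: power2_eq_square power3_eq_cube algebra_simps)
  then show ?thesis
    by (rule expands_cong) (use eventually_regime in \<open>auto elim: eventually_mono\<close>)
qed

text \<open>
  Multiplying numerator and denominator by \<open>b n\<close> makes both converge: the numerator becomes
  \<open>b * (t - b) - b * (s - b) + 2 * L\<^sup>2 * (s / b)\<close> because \<open>w * (1 - r) = 2 * L\<^sup>2\<close>.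
\<close>
lemma expands_threshold:
  "expands w (threshold u v) (lam + (v - u) / (2 * lam))
     (((v\<^sup>2 - u\<^sup>2) / 2 - 4 * lam * \<tau> + 2 * lam\<^sup>2 * u + (lam + (v - u) / (2 * lam)) * (2 * \<tau> + lam ^ 3))
        / (2 * lam))"
proof -
  let ?N = "\<lambda>n. w n * (exp (v / w n) - 1) - w n * (exp (u / w n) - 1)
      + 2 * (L n)\<^sup>2 * (level u n / b n)"
  have "expands w ?N (v - u + 2 * lam\<^sup>2 * 1)
      (v\<^sup>2 / 2 - u\<^sup>2 / 2 + (2 * (- 2 * lam * \<tau>) * 1 + 2 * lam\<^sup>2 * u))"
    by (intro expands_add expands_diff expands_mult expands_cmult
      expands_exp_difference_quotient w_at_top expands_L_squared expands_level)
  from expands_divide[OF this expands_b_sigma]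
  have "expands w (\<lambda>n. ?N n / (b n * \<sigma> n)) ((v - u + 2 * lam\<^sup>2) / (2 * lam))
     ((v\<^sup>2 / 2 - u\<^sup>2 / 2 - 4 * lam * \<tau> + 2 * lam\<^sup>2 * u
        - (v - u + 2 * lam\<^sup>2) / (2 * lam) * (- 2 * \<tau> - lam ^ 3)) / (2 * lam))"
    using lam by (simp add: algebra_simps)
  moreover have "(v - u + 2 * lam\<^sup>2) / (2 * lam) = lam + (v - u) / (2 * lam)"
    using lam by (simp add: field_simps power2_eq_square)
  moreover have "v\<^sup>2 / 2 - u\<^sup>2 / 2 - 4 * lam * \<tau> + 2 * lam\<^sup>2 * u - x * (- 2 * \<tau> - lam ^ 3)
      = (v\<^sup>2 - u\<^sup>2) / 2 - 4 * lam * \<tau> + 2 * lam\<^sup>2 * u + x * (2 * \<tau> + lam ^ 3)" for x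
    by (simp add: algebra_simps diff_divide_distrib)
  ultimately have "expands w (\<lambda>n. ?N n / (b n * \<sigma> n)) (lam + (v - u) / (2 * lam))
     (((v\<^sup>2 - u\<^sup>2) / 2 - 4 * lam * \<tau> + 2 * lam\<^sup>2 * u + (lam + (v - u) / (2 * lam)) * (2 * \<tau> + lam ^ 3))
        / (2 * lam))"
    by (simp only:)
  moreover have "eventually (\<lambda>n. ?N n / (b n * \<sigma> n) = threshold u v n) sequentially"
    using eventually_regime
  proof eventually_elim
    case (elim n)
    have "?N n = b n * (level v n - r n * level u n)"
      using elim by (simp add: level_def r_def field_simps power2_eq_square)
    then have "?N n / (b n * \<sigma> n) = (b n * (level v n - r n * level u n)) / (b n * \<sigma> n)" by simp
    also have "\<dots> = threshold u v n"
      unfolding threshold_def using elim by (intro mult_divide_mult_cancel_left) simp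
    finally show ?case .
  qed
  ultimately show ?thesis by (rule expands_cong)
qed

text \<open>
  The correction \<open>- 1\<close> comes from \<open>z * mills_ratio z = 1 - 1 / z\<^sup>2 + o(1 / z\<^sup>2)\<close>, the correction
  \<open>- c\<close> from the factor \<open>b / z\<close>.
\<close>
lemma expands_mills_ratio:
  assumes z: "expands w (\<lambda>n. z n / b n) 1 c"
  shows "expands w (\<lambda>n. b n * mills_ratio (z n)) 1 (- 1 - c)"
proof -
  note zb = expands_tendsto[OF z]
  have "filterlim (\<lambda>n. z n / b n * b n) at_top sequentially"
    by (rule filterlim_tendsto_pos_mult_at_top[OF zb _ b]) simp
  moreover have ev: "eventually (\<lambda>n. z n / b n * b n = z n) sequentially"
    using eventually_b_gt[of 0] by eventually_elim simp
  ultimately have z_top: "filterlim z at_top sequentially"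
    using filterlim_cong[OF refl refl ev] by simp
  then have zpos: "eventually (\<lambda>n. z n > 0) sequentially"
    using filterlim_at_top_dense[THEN iffD1, of z sequentially] by blast
  have "(\<lambda>n. (z n)\<^sup>2 * (z n * mills_ratio (z n) - 1) / (z n / b n)\<^sup>2) \<longlonglongrightarrow> - 1 / 1\<^sup>2"
    by (intro tendsto_divide tendsto_power zb filterlim_compose[OF mills_ratio_second_order z_top]) simp
  moreover have "eventually (\<lambda>n. (z n)\<^sup>2 * (z n * mills_ratio (z n) - 1) / (z n / b n)\<^sup>2
      = w n * (z n * mills_ratio (z n) - 1)) sequentially"
    using eventually_b_gt[of 0] zpos by eventually_elim (simp add: field_simps)
  ultimately have "expands w (\<lambda>n. z n * mills_ratio (z n)) 1 (- 1)"
    using w_at_top by (simp add: expands_def tendsto_cong)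
  from expands_divide[OF this z]
  have "expands w (\<lambda>n. z n * mills_ratio (z n) / (z n / b n)) 1 (- 1 - c)" by simp
  then show ?thesis
    by (rule expands_cong) (use eventually_b_gt[of 0] zpos in eventually_elim, simp)
qed

text \<open>
  The quotient of the densities is \<open>exp (- (t\<^sup>2 - b\<^sup>2) / 2)\<close> with \<open>t = level v n\<close>; its exponent
  \<open>- v - v\<^sup>2 / w + o(1 / w)\<close> accounts for \<open>- v\<^sup>2\<close>. The quotient of the Mills ratios,
  \<open>1 - v / w + o(1 / w)\<close>, accounts for \<open>- v\<close>.
\<close>
lemma expands_normal_tail:
  "expands w (\<lambda>n. normal_tail (level v n) / normal_tail (b n)) (exp (- v)) (- (v\<^sup>2 + v) * exp (- v))"
proof -
  have "expands w (\<lambda>n. - 1 / 2 * (w n * (exp (2 * v / w n) - 1))) (- 1 / 2 * (2 * v)) (- 1 / 2 * ((2 * v)\<^sup>2 / 2))"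
    by (intro expands_cmult expands_exp_difference_quotient w_at_top)
  from expands_compose[OF this DERIV_exp]
  have *: "expands w (\<lambda>n. exp (- 1 / 2 * (w n * (exp (2 * v / w n) - 1)))) (exp (- v)) (exp (- v) * (- v\<^sup>2))"
    by (simp add: power_mult_distrib)
  have "expands w (\<lambda>n. b n / b n) 1 0"
    by (rule expands_cong[OF expands_const[OF w_at_top]])
       (use eventually_b_gt[of 0] in eventually_elim, simp)
  from expands_divide[OF expands_mills_ratio[OF expands_level[of v]] expands_mills_ratio[OF this]]
  have "expands w (\<lambda>n. b n * mills_ratio (level v n) / (b n * mills_ratio (b n))) 1 (- v)" by simp
  from expands_mult[OF * this]
  have "expands w (\<lambda>n. exp (- 1 / 2 * (w n * (exp (2 * v / w n) - 1))) *
      (b n * mills_ratio (level v n) / (b n * mills_ratio (b n)))) (exp (- v)) (- (v\<^sup>2 + v) * exp (- v))"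
    by (simp add: algebra_simps)
  then show ?thesis
  proof (rule expands_cong)
    show "eventually (\<lambda>n. exp (- 1 / 2 * (w n * (exp (2 * v / w n) - 1))) *
      (b n * mills_ratio (level v n) / (b n * mills_ratio (b n)))
       = normal_tail (level v n) / normal_tail (b n)) sequentially"
      using eventually_b_gt[of 0]
    proof eventually_elim
      case (elim n)
      have "(level v n)\<^sup>2 = w n * exp (2 * v / w n)"
        by (simp add: level_def power_mult_distrib exp_double[symmetric])
      then have "std_normal_density (level v n) / std_normal_density (b n)
          = exp (- 1 / 2 * (w n * (exp (2 * v / w n) - 1)))"
        by (simp add: std_normal_density_def exp_diff[symmetric] field_simps)
      then have "exp (- 1 / 2 * (w n * (exp (2 * v / w n) - 1)))
          = std_normal_density (level v n) / std_normal_density (b n)" ..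
      then show ?case using elim
        by (simp only: normal_tail_eq_mills) (simp add: mult.commute)
    qed
  qed
qed

text \<open>
  The second-order corrections of the two Mills ratios cancel, as do the contributions of
  \<open>v\<close> and \<open>lam\<^sup>2\<close>: only the displacement \<open>\<sigma> * q\<close> of the argument survives.
\<close>
lemma expands_mills_quotient:
  "expands w (\<lambda>n. r n * mills_ratio (r n * level v n + \<sigma> n * q) / mills_ratio (level v n)) 1 (- 2 * lam * q)"
proof -
  have "expands w (\<lambda>n. r n * (level v n / b n) + b n * \<sigma> n * q / w n) (1 * 1 + 0) (- 2 * lam\<^sup>2 * 1 + 1 * v + 2 * lam * q)"
    by (intro expands_add expands_mult expands_r expands_level expands_vanishing w_at_top
      tendsto_mult expands_tendsto[OF expands_b_sigma] tendsto_const)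
  then have "expands w (\<lambda>n. (r n * level v n + \<sigma> n * q) / b n) 1 (- 2 * lam\<^sup>2 + v + 2 * lam * q)"
    by (simp, elim expands_cong, use eventually_b_gt[of 0] in eventually_elim)
       (simp add: field_simps power2_eq_square)
  from expands_divide[OF expands_mult[OF expands_r expands_mills_ratio[OF this]] expands_mills_ratio[OF expands_level[of v]]]
  have "expands w (\<lambda>n. r n * (b n * mills_ratio (r n * level v n + \<sigma> n * q)) / (b n * mills_ratio (level v n))) 1 (- 2 * lam * q)"
    by simp
  then show ?thesis
    by (rule expands_cong) (use eventually_b_gt[of 0] in eventually_elim, simp)
qed

text \<open>
  Dominated convergence. The indicators converge off the limit \<open>B\<close> of the thresholds, and the
  limit integral is a truncated first moment of the normal law.
\<close>
lemma expands_mills_integral: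
  "expands w (\<lambda>n. LINT q|lborel. indicator {threshold v u n..} q *
       ((r n * mills_ratio (r n * level v n + \<sigma> n * q) / mills_ratio (level v n) - 1) * std_normal_density q))
     0 (- 2 * lam * std_normal_density (lam + (u - v) / (2 * lam)))"
proof -
  define B where "B = lam + (u - v) / (2 * lam)"
  define f where "f n q = indicator {threshold v u n..} q *
    (w n * (r n * mills_ratio (r n * level v n + \<sigma> n * q) / mills_ratio (level v n) - 1) * std_normal_density q)" for n q
  define h where "h q = (4 * (2 * lam + 1) * \<bar>q\<bar> + 8) * std_normal_density q" for q
  have [measurable]: "mills_ratio \<in> borel_measurable borel"
    unfolding mills_ratio_def[abs_def] by measurable
  have B: "threshold v u \<longlonglongrightarrow> B"
    using expands_tendsto[OF expands_threshold[of v u]] by (simp add: B_def)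
  have level_ev: "eventually (\<lambda>n. level c n \<ge> b n / 2) sequentially" for c
  proof -
    have "eventually (\<lambda>n. level c n / b n > 1 / 2) sequentially"
      by (rule order_tendstoD(1)[OF expands_tendsto[OF expands_level]]) simp
    with eventually_b_gt[of 0] show ?thesis
      by eventually_elim (simp add: field_simps)
  qed
  have "eventually (\<lambda>n. b n * \<sigma> n < 2 * lam + 1) sequentially"
    by (rule order_tendstoD(2)[OF expands_tendsto[OF expands_b_sigma]]) simp
  with eventually_regime level_ev[of v] level_ev[of u]
  have "eventually (\<lambda>n. \<forall>q. norm (f n q) \<le> h q) sequentially"
  proof eventually_elim
    case (elim n)
    show ?case
    proof
      fix q
      show "norm (f n q) \<le> h q"
      proof (cases "threshold v u n \<le> q")
        case True
        define z where "z = r n * level v n + \<sigma> n * q"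
        have "level u n \<le> z" using True elim by (simp add: threshold_def z_def field_simps)
        then have "w n * \<bar>r n * mills_ratio z / mills_ratio (level v n) - 1\<bar>
             \<le> 4 * (b n * \<sigma> n) * \<bar>q\<bar> + 8"
          using elim by (intro mills_ratio_quotient_bound[where t = "level v n"]) (auto simp: z_def)
        also have "\<dots> \<le> 4 * (2 * lam + 1) * \<bar>q\<bar> + 8"
          using elim by (intro add_mono mult_right_mono mult_left_mono) auto
        finally have "w n * \<bar>r n * mills_ratio z / mills_ratio (level v n) - 1\<bar> * std_normal_density q \<le> h q"
          unfolding h_def by (intro mult_right_mono) auto
        then show ?thesis using True by (simp add: f_def z_def abs_mult)
      next
        case False
        then show ?thesis using lam by (simp add: f_def h_def)
      qed
    qed
  qed
  then obtain N where N: "\<And>n q. n \<ge> N \<Longrightarrow> norm (f n q) \<le> h q"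
    unfolding eventually_sequentially by blast
  \<comment> \<open>The bound holds only from \<open>N\<close> on, hence the shifted sequence.\<close>
  have "(\<lambda>n. LINT q|lborel. f (n + N) q) \<longlonglongrightarrow> (LINT q|lborel. indicator {B..} q * (- 2 * lam * q * std_normal_density q))"
  proof (rule integral_dominated_convergence)
    show "integrable lborel h"
      unfolding h_def using integrable_std_normal_moment_abs[of 1]
      by (auto simp: distrib_right mult.assoc mult.commute[of "\<bar>_\<bar>"])
    show "(\<lambda>q. indicator {B..} q * (- 2 * lam * q * std_normal_density q)) \<in> borel_measurable lborel"
      by measurable
    show "f (n + N) \<in> borel_measurable lborel" for n
      unfolding f_def by measurable
    show "AE q in lborel. norm (f (n + N) q) \<le> h q" for n
      using N by simp
    show "AE q in lborel. (\<lambda>n. f (n + N) q) \<longlonglongrightarrow> indicator {B..} q * (- 2 * lam * q * std_normal_density q)"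
    proof (rule AE_I[where N="{B}"])
      show "{q \<in> space lborel. \<not> (\<lambda>n. f (n + N) q) \<longlonglongrightarrow> indicator {B..} q * (- 2 * lam * q * std_normal_density q)} \<subseteq> {B}"
      proof (rule subsetI, rule ccontr)
        fix q assume *: "q \<in> {q \<in> space lborel. \<not> (\<lambda>n. f (n + N) q) \<longlonglongrightarrow> indicator {B..} q * (- 2 * lam * q * std_normal_density q)}"
          and "q \<notin> {B}"
        then consider "q < B" | "q > B" by force
        then have "eventually (\<lambda>n. indicator {threshold v u n..} q = (indicator {B..} q :: real)) sequentially"
        proof cases
          case 1
          show ?thesis using order_tendstoD(1)[OF B 1]
            by eventually_elim (use 1 in \<open>simp add: indicator_def\<close>)
        next
          case 2
          show ?thesis using order_tendstoD(2)[OF B 2]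
            by eventually_elim (use 2 in \<open>simp add: indicator_def\<close>)
        qed
        then have ind: "(\<lambda>n. indicator {threshold v u n..} q) \<longlonglongrightarrow> (indicator {B..} q :: real)"
          by (rule tendsto_eventually)
        have "(\<lambda>n. w n * (r n * mills_ratio (r n * level v n + \<sigma> n * q) / mills_ratio (level v n) - 1))
            \<longlonglongrightarrow> - 2 * lam * q"
          using expands_mills_quotient[of v q] unfolding expands_def by blast
        then have "(\<lambda>n. f n q) \<longlonglongrightarrow> indicator {B..} q * (- 2 * lam * q * std_normal_density q)"
          unfolding f_def by (intro tendsto_mult[OF ind] tendsto_mult[OF _ tendsto_const])
        with * show False using LIMSEQ_ignore_initial_segment[of "\<lambda>n. f n q" _ N] by auto
      qed
    qed auto
  qed
  then have "(\<lambda>n. LINT q|lborel. f n q) \<longlonglongrightarrow> (LINT q|lborel. indicator {B..} q * (- 2 * lam * q * std_normal_density q))"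
    by (rule LIMSEQ_offset)
  also have "(LINT q|lborel. indicator {B..} q * (- 2 * lam * q * std_normal_density q))
     = (LINT q|lborel. (- 2 * lam) * (indicator {B..} q * (q * std_normal_density q)))"
    by (rule Bochner_Integration.integral_cong) auto
  also have "\<dots> = - 2 * lam * std_normal_density B"
    by (simp add: integral_first_moment_std_normal_density_Ici del: mult_minus_left)
  also have "(\<lambda>n. LINT q|lborel. f n q) = (\<lambda>n. w n * (LINT q|lborel. indicator {threshold v u n..} q *
       ((r n * mills_ratio (r n * level v n + \<sigma> n * q) / mills_ratio (level v n) - 1) * std_normal_density q)))"
    unfolding f_def by (subst integral_mult_right_zero[symmetric]) (simp add: mult_ac)
  finally show ?thesis using w_at_top by (simp add: expands_def B_def)
qed

text \<open>
  The first-order terms of the two thresholds add up to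
  \<open>lam * (u + v) + lam ^ 3 - 2 * \<tau>\<close>, and the integral contributes \<open>2 * lam\<close>. Both come with
  the same density factor, as \<open>exp (- u) * std_normal_density A\<close> is symmetric under exchange
  of \<open>(u, A)\<close> and \<open>(v, B)\<close>.
\<close>
lemma expands_exceedance:
  assumes nb: "eventually (\<lambda>n. real n * normal_tail (b n) = 1) sequentially"
    and p: "eventually (\<lambda>n. p n = normal_tail (level u n) * std_normal_cdf (threshold u v n)
      + normal_tail (level v n) * (std_normal_cdf (threshold v u n) -
          (LINT q|lborel. indicator {threshold v u n..} q *
       ((r n * mills_ratio (r n * level v n + \<sigma> n * q) / mills_ratio (level v n) - 1) * std_normal_density q))))
      sequentially"
  shows "expands w (\<lambda>n. real n * p n)
    (std_normal_cdf (lam + (v - u) / (2 * lam)) * exp (- u) + std_normal_cdf (lam + (u - v) / (2 * lam)) * exp (- v))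
    (- ((u\<^sup>2 + u) * exp (- u) * std_normal_cdf (lam + (v - u) / (2 * lam))
      + (v\<^sup>2 + v) * exp (- v) * std_normal_cdf (lam + (u - v) / (2 * lam))
      + (2 * \<tau> - lam ^ 3 - 2 * lam - lam * v - lam * u) * exp (- u)
          * std_normal_density (lam + (v - u) / (2 * lam))))"
proof -
  define A B where "A = lam + (v - u) / (2 * lam)" and "B = lam + (u - v) / (2 * lam)"
  define A' B' where "A' = ((v\<^sup>2 - u\<^sup>2) / 2 - 4 * lam * \<tau> + 2 * lam\<^sup>2 * u + A * (2 * \<tau> + lam ^ 3)) / (2 * lam)"
    and "B' = ((u\<^sup>2 - v\<^sup>2) / 2 - 4 * lam * \<tau> + 2 * lam\<^sup>2 * v + B * (2 * \<tau> + lam ^ 3)) / (2 * lam)"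
  define Q where "Q n = (LINT q|lborel. indicator {threshold v u n..} q *
     ((r n * mills_ratio (r n * level v n + \<sigma> n * q) / mills_ratio (level v n) - 1) * std_normal_density q))" for n
  have der: "(std_normal_cdf has_real_derivative std_normal_density x) (at x)" for x
    using has_real_derivative_std_normal_cdf[OF DERIV_ident, of x UNIV] by simp
  have A: "expands w (threshold u v) A A'" and B: "expands w (threshold v u) B B'"
    using expands_threshold by (simp_all add: A_def B_def A'_def B'_def)
  have Q: "expands w Q 0 (- 2 * lam * std_normal_density B)"
    using expands_mills_integral[of v u] unfolding Q_def[abs_def] B_def .
  let ?T = "\<lambda>c n. normal_tail (level c n) / normal_tail (b n)"
  have "expands w (\<lambda>n. ?T u n * std_normal_cdf (threshold u v n)
        + ?T v n * (std_normal_cdf (threshold v u n) - Q n))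
      (exp (- u) * std_normal_cdf A + exp (- v) * (std_normal_cdf B - 0))
      ((- (u\<^sup>2 + u) * exp (- u) * std_normal_cdf A + exp (- u) * (std_normal_density A * A'))
       + (- (v\<^sup>2 + v) * exp (- v) * (std_normal_cdf B - 0)
          + exp (- v) * (std_normal_density B * B' - (- 2 * lam * std_normal_density B))))"
    by (intro expands_add expands_mult expands_diff expands_normal_tail Q
      expands_compose[OF A der] expands_compose[OF B der])
  moreover have "(- (u\<^sup>2 + u) * exp (- u) * std_normal_cdf A + exp (- u) * (std_normal_density A * A'))
       + (- (v\<^sup>2 + v) * exp (- v) * (std_normal_cdf B - 0)
          + exp (- v) * (std_normal_density B * B' - (- 2 * lam * std_normal_density B)))
     = - ((u\<^sup>2 + u) * exp (- u) * std_normal_cdf A + (v\<^sup>2 + v) * exp (- v) * std_normal_cdf B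
      + (2 * \<tau> - lam ^ 3 - 2 * lam - lam * v - lam * u) * exp (- u) * std_normal_density A)"
  proof -
    have "B\<^sup>2 / 2 + v = A\<^sup>2 / 2 + u"
      using lam by (simp add: A_def B_def power2_eq_square field_simps)
    then have "- v + - B\<^sup>2 / 2 = - u + - A\<^sup>2 / 2" by simp
    then have "exp (- v) * exp (- B\<^sup>2 / 2) = exp (- u) * exp (- A\<^sup>2 / 2)"
      unfolding exp_add[symmetric] by simp
    then have \<phi>: "exp (- v) * std_normal_density B = exp (- u) * std_normal_density A"
      by (simp add: std_normal_density_def)
    have "A + B = 2 * lam"
      by (simp add: A_def B_def diff_divide_distrib)
    have "A' + B' = (2 * lam\<^sup>2 * (u + v) - 8 * lam * \<tau> + (A + B) * (2 * \<tau> + lam ^ 3)) / (2 * lam)"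
      by (simp add: A'_def B'_def add_divide_distrib[symmetric] diff_divide_distrib[symmetric] algebra_simps)
    also have "\<dots> = lam * (u + v) + lam ^ 3 - 2 * \<tau>"
      unfolding \<open>A + B = 2 * lam\<close> using lam by (simp add: field_simps power2_eq_square)
    finally have B': "B' = lam * (u + v) + lam ^ 3 - 2 * \<tau> - A'" by simp
    have "exp (- v) * (std_normal_density B * B' - (- 2 * lam * std_normal_density B))
        = exp (- u) * std_normal_density A * (B' + 2 * lam)"
      unfolding \<phi>[symmetric] by (simp add: algebra_simps)
    then show ?thesis unfolding B' by (simp add: algebra_simps)
  qed
  ultimately have *: "expands w (\<lambda>n. ?T u n * std_normal_cdf (threshold u v n)
        + ?T v n * (std_normal_cdf (threshold v u n) - Q n))
      (std_normal_cdf A * exp (- u) + std_normal_cdf B * exp (- v))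
      (- ((u\<^sup>2 + u) * exp (- u) * std_normal_cdf A + (v\<^sup>2 + v) * exp (- v) * std_normal_cdf B
      + (2 * \<tau> - lam ^ 3 - 2 * lam - lam * v - lam * u) * exp (- u) * std_normal_density A))"
    by (simp add: mult.commute)
  show ?thesis
    unfolding A_def[symmetric] B_def[symmetric]
  proof (rule expands_cong[OF *])
    show "eventually (\<lambda>n. ?T u n * std_normal_cdf (threshold u v n)
        + ?T v n * (std_normal_cdf (threshold v u n) - Q n) = real n * p n) sequentially"
      using nb p
    proof eventually_elim
      case (elim n)
      have "real n = 1 / normal_tail (b n)"
        using elim(1) normal_tail_pos[of "b n"] by (simp add: field_simps)
      then show ?case
        unfolding elim(2) Q_def[symmetric] by (simp add: add_divide_distrib)
    qed
  qed
qed

end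

section \<open>Norming constants and the limit theorem\<close>

text \<open>
  If \<open>b n < Z\<close>, then \<open>n * normal_tail Z \<le> 1\<close>, which fails for large \<open>n\<close> because the normal
  tail is positive.
\<close>
lemma norming_constants_at_top:
  assumes nb: "eventually (\<lambda>n. real n * normal_tail (b n) = 1) sequentially"
  shows "filterlim b at_top sequentially"
proof (rule filterlim_at_top[THEN iffD2], intro allI)
  fix Z :: real
  have "eventually (\<lambda>n. real n > 1 / normal_tail Z) sequentially"
    using filterlim_at_top_dense[THEN iffD1, OF filterlim_real_sequentially] by blast
  with nb show "eventually (\<lambda>n. Z \<le> b n) sequentially"
  proof eventually_elim
    case (elim n)
    show ?case
    proof (rule ccontr)
      assume "\<not> Z \<le> b n"
      then have "normal_tail Z \<le> normal_tail (b n)"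
        by (simp add: normal_tail_def std_normal.cdf_nondecreasing)
      then have "real n * normal_tail Z \<le> 1"
        using elim(1) mult_left_mono[of "normal_tail Z" "normal_tail (b n)" "real n"] by simp
      with elim(2) normal_tail_pos[of Z] show False by (simp add: field_simps)
    qed
  qed
qed

text \<open>
  As \<open>1 / n = normal_tail (b n)\<close>, the Mills bound \<open>normal_tail z \<le> std_normal_density z / z\<close>
  leaves \<open>b n * std_normal_density (b n)\<close>.
\<close>
lemma norming_constants_squared_small:
  assumes nb: "eventually (\<lambda>n. real n * normal_tail (b n) = 1) sequentially"
  shows "(\<lambda>n. (b n)\<^sup>2 / real n) \<longlonglongrightarrow> 0"
proof (rule tendsto_sandwich)
  note b = norming_constants_at_top[OF nb]
  show "eventually (\<lambda>n. 0 \<le> (b n)\<^sup>2 / real n) sequentially" by simp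
  have "((\<lambda>x::real. x * exp (- x\<^sup>2 / 2)) \<longlongrightarrow> 0) at_top"
    by real_asymp
  from tendsto_mult[OF tendsto_const this, of "1 / sqrt (2 * pi)"]
  have "((\<lambda>x. x * std_normal_density x) \<longlongrightarrow> 0) at_top"
    by (simp add: std_normal_density_def mult_ac)
  then show "(\<lambda>n. b n * std_normal_density (b n)) \<longlonglongrightarrow> 0"
    by (rule filterlim_compose[OF _ b])
  have "eventually (\<lambda>n. b n > 0) sequentially"
    using filterlim_at_top_dense[THEN iffD1, OF b] by blast
  with nb show "eventually (\<lambda>n. (b n)\<^sup>2 / real n \<le> b n * std_normal_density (b n)) sequentially"
  proof eventually_elim
    case (elim n)
    have "1 / real n = normal_tail (b n)"
      using elim(1) by (cases "n = 0") (simp_all add: field_simps)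
    then have "(b n)\<^sup>2 / real n = b n * (b n * mills_ratio (b n)) * std_normal_density (b n)"
      by (simp add: divide_inverse normal_tail_eq_mills power2_eq_square)
    also have "\<dots> \<le> b n * 1 * std_normal_density (b n)"
      using elim mills_ratio_upper[of "b n"] by (intro mult_right_mono mult_left_mono) auto
    finally show ?case by simp
  qed
qed simp

theorem theorem2p2:
  fixes M :: "'a measure"
    and X Y :: "nat \<Rightarrow> nat \<Rightarrow> 'a \<Rightarrow> real"
    and \<rho> b lam_seq :: "nat \<Rightarrow> real"
    and F :: "nat \<Rightarrow> real \<Rightarrow> real \<Rightarrow> real"
    and lam \<tau> x y :: real
  assumes "prob_space M"
    and "prob_space.gaussian_triangular_array M X Y \<rho>"
    and "\<And>n s t. n \<ge> 1 \<Longrightarrow> F n s t = prob_space.joint_cdf M (X n 1) (Y n 1) s t"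
    and "\<And>n. n \<ge> 3 \<Longrightarrow> real n * (1 - std_normal_cdf (b n)) = 1"
    and "\<And>n. n \<ge> 3 \<Longrightarrow> lam_seq n = sqrt (1 / 2 * (b n)\<^sup>2 * (1 - \<rho> n))"
    and "lam > 0"
    and "(\<lambda>n. (b n)\<^sup>2 * (lam - lam_seq n)) \<longlonglongrightarrow> \<tau>"
    and "x > 0" and "y > 0"
  shows "(\<lambda>n. (b n)\<^sup>2 *
            ((F n (b n * x powr (inverse ((b n)\<^sup>2))) (b n * y powr (inverse ((b n)\<^sup>2)))) ^ n
             - husler_reiss lam (ln x) (ln y)))
         \<longlonglongrightarrow> kappa x y lam \<tau> * husler_reiss lam (ln x) (ln y)"
proof -
  interpret prob_space M by fact
  have nb: "eventually (\<lambda>n. real n * normal_tail (b n) = 1) sequentially"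
    using assms(4) unfolding normal_tail_def eventually_sequentially by blast
  have b: "filterlim b at_top sequentially" by (rule norming_constants_at_top[OF nb])
  interpret husler_reiss_regime b lam_seq lam \<tau>
  proof
    have "filterlim (\<lambda>n. (b n)\<^sup>2) at_top sequentially"
      by (rule filterlim_pow_at_top[OF _ b]) simp
    moreover have "(\<lambda>n. (b n)\<^sup>2 * (lam_seq n - lam)) \<longlonglongrightarrow> - \<tau>"
      using tendsto_minus[OF assms(7)] by (simp add: algebra_simps)
    ultimately show "expands (\<lambda>n. (b n)\<^sup>2) lam_seq lam (- \<tau>)" by (simp add: expands_def)
  qed (fact b assms(6))+
  define u v where "u = ln x" and "v = ln y"
  have level: "b n * x powr inverse ((b n)\<^sup>2) = level u n" "b n * y powr inverse ((b n)\<^sup>2) = level v n" for n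
    using assms(8,9) by (simp_all add: level_def u_def v_def powr_def divide_inverse mult.commute)
  define p where "p n = 1 - F n (level u n) (level v n)" for n
  have "expands w (\<lambda>n. real n * p n)
    (std_normal_cdf (lam + (v - u) / (2 * lam)) * exp (- u) + std_normal_cdf (lam + (u - v) / (2 * lam)) * exp (- v))
    (- ((u\<^sup>2 + u) * exp (- u) * std_normal_cdf (lam + (v - u) / (2 * lam))
      + (v\<^sup>2 + v) * exp (- v) * std_normal_cdf (lam + (u - v) / (2 * lam))
      + (2 * \<tau> - lam ^ 3 - 2 * lam - lam * v - lam * u) * exp (- u)
          * std_normal_density (lam + (v - u) / (2 * lam))))" (is "expands w _ ?c ?d")
  proof (rule expands_exceedance[OF nb])
    show "eventually (\<lambda>n. p n = normal_tail (level u n) * std_normal_cdf (threshold u v n)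
      + normal_tail (level v n) * (std_normal_cdf (threshold v u n) -
          (LINT q|lborel. indicator {threshold v u n..} q *
       ((r n * mills_ratio (r n * level v n + \<sigma> n * q) / mills_ratio (level v n) - 1) * std_normal_density q))))
      sequentially"
      using eventually_regime eventually_ge_at_top[of 3]
    proof eventually_elim
      case (elim n)
      have \<rho>: "\<rho> n \<le> 1" "standard_bivariate_gaussian (X n 1) (Y n 1)"
        "correlation (X n 1) (Y n 1) = \<rho> n"
        using assms(2) elim unfolding gaussian_triangular_array_def by auto
      have L2: "(lam_seq n)\<^sup>2 = 1 / 2 * (b n)\<^sup>2 * (1 - \<rho> n)"
        using assms(5)[of n] elim \<rho>(1) by simp
      have "2 * (lam_seq n)\<^sup>2 / (b n)\<^sup>2 = 1 - \<rho> n"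
        unfolding L2 using elim by simp
      then have "\<rho> n = r n" by (simp add: r_def)
      then have corr: "correlation (X n 1) (Y n 1) = r n" using \<rho>(3) by simp
      have "0 < r n" "r n < 1" using elim by auto
      from joint_cdf_standard_bivariate_gaussian[OF \<rho>(2) corr this, of "level u n" "level v n"]
      show ?case
        using assms(3)[of n] elim by (simp add: p_def threshold_def \<sigma>_def)
    qed
  qed
  from expands_power[OF this norming_constants_squared_small[OF nb]]
  have "(\<lambda>n. w n * ((1 - p n) ^ n - exp (- ?c))) \<longlonglongrightarrow> - ?d * exp (- ?c)"
    by (simp add: expands_def)
  moreover have "exp (- ?c) = husler_reiss lam (ln x) (ln y)"
    by (simp add: husler_reiss_def u_def v_def)
  moreover have "- ?d = kappa x y lam \<tau>"
    using assms(8,9) by (simp add: kappa_def u_def v_def exp_minus ln_div)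
  ultimately show ?thesis by (simp add: p_def level)
qed

end
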